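(* Let $(M,\tau)$ be a tracial von Neumann algebra generated by a unital von Neumann subalgebra $B\le M$ and a tuple of self-adjoint operators $\mathbf{x}=(x_i)_{i\in I}$ in $M$, with $I$ countable. Assume that a $(B,\eta)$-conjugate system exists for $\mathbf{x}$, where $\eta$ is a $\tau$-symmetric covariance matrix with $\eta_{ii}=E_B$ for all $i\in I$. (1) Let $i\in I$ and let $P=\sum_{j}a_jx_ib_j+b_0$ (a finite sum) be self-adjoint, with $a_j,b_j,b_0\in B$. If there exists a scalar $c>0$ such that $\sum_j a_jb_j\ge c\cdot 1$, then $P$ has no atoms in $B$. (2) Assume furthermore that $\eta=(\delta_{ij}E_B)_{i,j\in I}$. Let $P=\sum_{i}\sum_{j}a^{(i)}_jx_ib^{(i)}_j+b_0$ (a finite sum) be self-adjoint, with $a_j^{(i)},b_j^{(i)},b_0\in B$. If there exist an index $i\in I$ and a scalar $c>0$ such that $\sum_j a_j^{(i)}b_j^{(i)}\ge c\cdot 1$, then $P$ has no atoms in $B$.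
   Context: A tracial von Neumann algebra $(M,\tau)$ is a von Neumann algebra $M$ with a faithful normal tracial state $\tau$. $L^2(M,\tau)$ is the GNS Hilbert space with $\langle a,b\rangle_\tau=\tau(a^*b)$. $E_B:M\to B$ is the unique $\tau$-preserving faithful normal conditional expectation. $B\langle\mathbf{x}\rangle$ is the $*$-algebra generated by $B$ and $\{x_i:i\in I\}$; that $M$ is generated by $B$ and $\mathbf{x}$ means $M=B\langle\mathbf{x}\rangle''$. A self-adjoint $x\in M$ has no atoms in $B$ if $\ker(x-b)=0$ for every self-adjoint $b\in B$. Covariance matrices. A covariance matrix on $B$ is a normal completely positive map $\eta:B\to B\otimes B(\ell^2(I))$ of the form $\eta(b)=\sum_{i,j\in I}\eta_{ij}(b)\otimes e_{ij}$ ($\sigma$-weak convergence), where $\eta_{ij}:B\to B$ are linear and $(e_{ij})$ are matrix units of $B(\ell^2(I))$. It is extended to $M$ by $\eta:=\eta\circ E_B$, i.e. $\eta_{ij}:=\eta_{ij}\circ E_B:M\to B$; thus "$\eta_{ii}=E_B$" means $\eta_{ii}=\mathrm{id}_B$ on $B$. It is $\tau$-symmetric if $\tau(\eta_{ij}(a)b)=\tau(a\,\eta_{ji}(b))$ for all $a,b\in B$, $i,j\in I$. Conjugate systems. A vector $\xi_i\in L^2(M,\tau)$ is the $i$-th $(B,\eta)$-conjugate variable for $\mathbf{x}$ if for all $d\ge 0$, $j_1,\dots,j_d\in I$ and $b_0,\dots,b_d\in B$, $$\langle \xi_i, b_0x_{j_1}b_1\cdots x_{j_d}b_d\rangle_\tau=\sum_{k=1}^d\tau\big(\eta_{ij_k}(b_0x_{j_1}\cdots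 x_{j_{k-1}}b_{k-1})\,E_B(b_kx_{j_{k+1}}\cdots x_{j_d}b_d)\big)$$ (for $d=0$ the right-hand side is $0$). A $(B,\eta)$-conjugate system for $\mathbf{x}$ is a tuple $(\xi_i)_{i\in I}$ such that each $\xi_i$ is the $i$-th $(B,\eta)$-conjugate variable. *)

theory Defs
  imports "HOL-Analysis.Analysis"
begin

section \<open>Complex Hilbert spaces\<close>

class complex_vector = real_vector +
  fixes scaleC :: "complex \<Rightarrow> 'a \<Rightarrow> 'a"  (infixr \<open>*\<^sub>C\<close> 75)
  assumes scaleC_add_right: "c *\<^sub>C (x + y) = c *\<^sub>C x + c *\<^sub>C y"
    and scaleC_add_left: "(c + d) *\<^sub>C x = c *\<^sub>C x + d *\<^sub>C x"
    and scaleC_scaleC: "c *\<^sub>C d *\<^sub>C x = (c * d) *\<^sub>C x"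
    and scaleR_scaleC: "r *\<^sub>R x = complex_of_real r *\<^sub>C x"

text \<open>The inner product is linear in the second argument.  It is tied to the inner product
  of the library, so that norm, topology and completeness are those of the underlying real
  Hilbert space.\<close>

class chilbert = complex_vector + real_inner + complete_space +
  fixes cinner :: "'a \<Rightarrow> 'a \<Rightarrow> complex"
  assumes cinner_commute: "cinner x y = cnj (cinner y x)"
    and cinner_add_right: "cinner x (y + z) = cinner x y + cinner x z"
    and cinner_scaleC_right: "cinner x (c *\<^sub>C y) = c * cinner x y"
    and Re_cinner: "Re (cinner x y) = inner x y"

lemma scaleC_one [simp]: "1 *\<^sub>C x = (x :: 'a::complex_vector)"
  using scaleR_scaleC[of 1 x] by simp

lemma scaleC_zero_left [simp]: "0 *\<^sub>C x = (0 :: 'a::complex_vector)"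
  using scaleR_scaleC[of 0 x] by simp

lemma scaleC_zero_right [simp]: "c *\<^sub>C 0 = (0 :: 'a::complex_vector)"
  using scaleC_add_right[of c 0 "0::'a"] by simp

lemma scaleC_minus_right: "c *\<^sub>C (- x) = - (c *\<^sub>C x :: 'a::complex_vector)"
  using scaleC_add_right[of c x "- x"] by (simp add: eq_neg_iff_add_eq_0 add.commute)

lemma scaleC_diff_right: "c *\<^sub>C (x - y) = c *\<^sub>C x - c *\<^sub>C (y :: 'a::complex_vector)"
  using scaleC_add_right[of c x "- y"] by (simp add: scaleC_minus_right)

lemma scaleC_scaleR: "c *\<^sub>C r *\<^sub>R x = r *\<^sub>R c *\<^sub>C (x :: 'a::complex_vector)"
  by (simp add: scaleR_scaleC scaleC_scaleC mult.commute)

lemma cinner_self: "cinner x x = complex_of_real ((norm (x :: 'a::chilbert))\<^sup>2)"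
proof -
  have "Im (cinner x x) = 0"
    using cinner_commute[of x x] by (simp add: complex_eq_iff)
  then show ?thesis
    by (simp add: complex_eq_iff Re_cinner power2_norm_eq_inner)
qed

lemma norm_scaleC: "norm (c *\<^sub>C x) = norm c * norm (x :: 'a::chilbert)"
proof -
  have "cinner (c *\<^sub>C x) (c *\<^sub>C x) = c * cnj c * cinner x x"
    by (metis cinner_commute cinner_scaleC_right complex_cnj_mult mult.assoc)
  then have "complex_of_real ((norm (c *\<^sub>C x))\<^sup>2) = complex_of_real ((norm c * norm x)\<^sup>2)"
    unfolding cinner_self complex_norm_square[symmetric] by (simp add: power_mult_distrib)
  then have "(norm (c *\<^sub>C x))\<^sup>2 = (norm c * norm x)\<^sup>2"
    using of_real_eq_iff by blast
  then show ?thesis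
    by (simp add: power2_eq_iff_nonneg)
qed

lemma cinner_norm_bound: "norm (cinner x y) \<le> norm x * norm (y :: 'a::chilbert)"
proof (cases "cinner x y = 0")
  case False
  define c where "c = cnj (cinner x y) / norm (cinner x y)"
  have nc: "norm c = 1"
    using False by (simp add: c_def norm_divide)
  have "cinner x (c *\<^sub>C y) = of_real (norm (cinner x y))"
    using False complex_norm_square[of "cinner x y"]
    by (simp add: cinner_scaleC_right c_def field_simps power2_eq_square)
  then have "norm (cinner x y) = inner x (c *\<^sub>C y)"
    using Re_cinner[of x "c *\<^sub>C y"] by simp
  also have "\<dots> \<le> norm x * norm (c *\<^sub>C y)"
    by (rule norm_cauchy_schwarz)
  finally show ?thesis
    by (simp add: norm_scaleC nc)
qed simp

instantiation complex :: chilbert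
begin
definition "scaleC_complex c (x :: complex) = c * x"
definition "cinner_complex x (y :: complex) = cnj x * y"
instance
  by standard (auto simp: scaleC_complex_def cinner_complex_def algebra_simps scaleR_conv_of_real
      inner_complex_def)
end


section \<open>Bounded operators\<close>

typedef (overloaded) 'h bop =
  "{f :: 'h \<Rightarrow> 'h::chilbert. bounded_linear f \<and> (\<forall>c x. f (c *\<^sub>C x) = c *\<^sub>C f x)}"
  morphisms app Bop
  by (rule exI[of _ "\<lambda>_. 0"]) (simp add: bounded_linear_zero)

setup_lifting type_definition_bop

lemma bop_eqI: "(\<And>v. app S v = app T v) \<Longrightarrow> S = T"
  by (metis app_inject ext)

lemma bounded_linear_app: "bounded_linear (app T)"
  using app[of T] by simp

lemma app_scaleC: "app T (c *\<^sub>C v) = c *\<^sub>C app T v"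
  using app[of T] by simp

instantiation bop :: (chilbert) "{ring, monoid_mult, complex_vector}"
begin
lift_definition zero_bop :: "'a bop" is "\<lambda>_. 0"
  by (simp add: bounded_linear_zero)
lift_definition one_bop :: "'a bop" is "\<lambda>v. v"
  by (simp add: bounded_linear_ident)
lift_definition plus_bop :: "'a bop \<Rightarrow> 'a bop \<Rightarrow> 'a bop" is "\<lambda>S T v. S v + T v"
  subgoal for S T using bounded_linear_add[of S T] by (simp add: scaleC_add_right)
  done
lift_definition uminus_bop :: "'a bop \<Rightarrow> 'a bop" is "\<lambda>S v. - S v"
  subgoal for S using bounded_linear_minus[of S] by (simp add: scaleC_minus_right)
  done
lift_definition minus_bop :: "'a bop \<Rightarrow> 'a bop \<Rightarrow> 'a bop" is "\<lambda>S T v. S v - T v"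
  subgoal for S T using bounded_linear_sub[of S T] by (simp add: scaleC_diff_right)
  done
lift_definition times_bop :: "'a bop \<Rightarrow> 'a bop \<Rightarrow> 'a bop" is "\<lambda>S T v. S (T v)"
  subgoal for S T using bounded_linear_compose[of S T] by simp
  done
lift_definition scaleR_bop :: "real \<Rightarrow> 'a bop \<Rightarrow> 'a bop" is "\<lambda>r S v. r *\<^sub>R S v"
  subgoal for r S using bounded_linear_const_scaleR[of S r] by (simp add: scaleC_scaleR)
  done
lift_definition scaleC_bop :: "complex \<Rightarrow> 'a bop \<Rightarrow> 'a bop" is "\<lambda>c S v. c *\<^sub>C S v"
proof
  fix c :: complex and S :: "'a \<Rightarrow> 'a"
  assume S: "bounded_linear S \<and> (\<forall>c x. S (c *\<^sub>C x) = c *\<^sub>C S x)"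
  have "bounded_linear (\<lambda>v::'a. c *\<^sub>C v)"
    by (rule bounded_linear_intro[of _ "norm c"])
       (simp_all add: scaleC_add_right scaleC_scaleR norm_scaleC mult.commute)
  from bounded_linear_compose[OF this, of S] S show "bounded_linear (\<lambda>v. c *\<^sub>C S v)"
    by simp
  show "\<forall>d x. c *\<^sub>C S (d *\<^sub>C x) = d *\<^sub>C c *\<^sub>C S x"
    using S by (simp add: scaleC_scaleC mult.commute)
qed
instance
proof
  fix a b c :: "'a bop" and r s :: real and z w :: complex
  have app_add: "app S (u + v) = app S u + app S v" for S :: "'a bop" and u v
    using bounded_linear_app[of S] by (simp add: linear_simps)
  show "a + b + c = a + (b + c)" "a + b = b + a" "0 + a = a" "- a + a = 0" "a - b = a + - b"
    "a * b * c = a * (b * c)" "(a + b) * c = a * c + b * c" "1 * a = a" "a * 1 = a"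
    by (auto intro!: bop_eqI simp: plus_bop.rep_eq zero_bop.rep_eq uminus_bop.rep_eq
        minus_bop.rep_eq times_bop.rep_eq one_bop.rep_eq)
  show "a * (b + c) = a * b + a * c"
    by (auto intro!: bop_eqI simp: plus_bop.rep_eq times_bop.rep_eq app_add)
  show "r *\<^sub>R (a + b) = r *\<^sub>R a + r *\<^sub>R b" "(r + s) *\<^sub>R a = r *\<^sub>R a + s *\<^sub>R a"
    "r *\<^sub>R s *\<^sub>R a = (r * s) *\<^sub>R a" "1 *\<^sub>R a = a"
    by (auto intro!: bop_eqI simp: plus_bop.rep_eq scaleR_bop.rep_eq scaleR_add_right
        scaleR_add_left)
  show "z *\<^sub>C (a + b) = z *\<^sub>C a + z *\<^sub>C b" "(z + w) *\<^sub>C a = z *\<^sub>C a + w *\<^sub>C a"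
    "z *\<^sub>C w *\<^sub>C a = (z * w) *\<^sub>C a" "r *\<^sub>R a = complex_of_real r *\<^sub>C a"
    by (auto intro!: bop_eqI simp: plus_bop.rep_eq scaleC_bop.rep_eq scaleR_bop.rep_eq
        scaleC_add_right scaleC_add_left scaleC_scaleC scaleR_scaleC)
qed
end

definition adj :: "'h::chilbert bop \<Rightarrow> 'h bop" where
  "adj T = (THE S. \<forall>u v. cinner (app S u) v = cinner u (app T v))"

lemma riesz_real:
  fixes \<phi> :: "'a::{real_inner, complete_space} \<Rightarrow> real"
  assumes "bounded_linear \<phi>"
  shows "\<exists>x. \<forall>h. inner x h = \<phi> h"
proof -
  interpret bounded_linear \<phi> by fact
  define q where "q y = (norm y)\<^sup>2 / 2 - \<phi> y" for y
  obtain K where K: "\<And>y. norm (\<phi> y) \<le> norm y * K"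
    using bounded by blast
  have qlow: "q y \<ge> - (K\<^sup>2 / 2)" for y
  proof -
    have "\<phi> y \<le> norm y * K" using K[of y] by simp
    moreover have "0 \<le> (norm y - K)\<^sup>2" by simp
    ultimately show ?thesis
      unfolding q_def by (simp add: power2_diff)
  qed
  then have bdd: "bdd_below (range q)" by (intro bdd_belowI2)
  define m where "m = Inf (range q)"
  have mq: "m \<le> q y" for y unfolding m_def by (rule cInf_lower) (use bdd in auto)
  have "\<exists>y. q y < m + 1 / real (Suc n)" for n
  proof -
    have "m < m + 1 / real (Suc n)" by simp
    then show ?thesis unfolding m_def
      using cInf_lessD[of "range q" "Inf (range q) + 1 / real (Suc n)"] by auto
  qed
  then obtain X where X: "\<And>n. q (X n) < m + 1 / real (Suc n)" by metis
  have par: "(dist x y)\<^sup>2 \<le> 4 * (q x - m) + 4 * (q y - m)" for x y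
  proof -
    have "(dist x y)\<^sup>2 = 4 * q x + 4 * q y - 8 * q ((1/2) *\<^sub>R (x + y))"
      unfolding q_def dist_norm power2_norm_eq_inner scaleR add
      by (simp add: inner_simps inner_commute field_simps)
    moreover have "8 * m \<le> 8 * q ((1/2) *\<^sub>R (x + y))"
      using mq by simp
    ultimately show ?thesis by (simp add: right_diff_distrib)
  qed
  have aux: "D < E" if "a \<le> c" "b \<le> c" "D \<le> 4 * (qa - m) + 4 * (qb - m)" "qa < m + a" "qb < m + b"
    "c < E / 8" for D E a b c qa qb :: real
    using that by argo
  have "Cauchy X"
  proof (rule metric_CauchyI)
    fix e :: real assume e: "e > 0"
    obtain N where N: "1 / real (Suc N) < e\<^sup>2 / 8"
      using e reals_Archimedean[of "e\<^sup>2 / 8"] by (auto simp: inverse_eq_divide)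
    show "\<exists>M. \<forall>m\<ge>M. \<forall>n\<ge>M. dist (X m) (X n) < e"
    proof (intro exI[of _ N] allI impI)
      fix k n assume "k \<ge> N" "n \<ge> N"
      then have "1 / real (Suc k) \<le> 1 / real (Suc N)" "1 / real (Suc n) \<le> 1 / real (Suc N)"
        by (auto intro!: divide_left_mono)
      then have "(dist (X k) (X n))\<^sup>2 < e\<^sup>2"
        by (rule aux[OF _ _ par X X N])
      then show "dist (X k) (X n) < e"
        using e power2_less_imp_less[of "dist (X k) (X n)" e] by simp
    qed
  qed
  then obtain x where x: "X \<longlonglongrightarrow> x"
    using Cauchy_convergent convergent_def by blast
  have "(\<lambda>n. q (X n)) \<longlonglongrightarrow> q x"
    unfolding q_def by (intro tendsto_intros x tendsto) simp
  moreover have "(\<lambda>n. m + 1 / real (Suc n)) \<longlonglongrightarrow> m + 0"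
    by (intro tendsto_intros LIMSEQ_Suc lim_1_over_n)
  ultimately have "q x \<le> m + 0"
    by (rule LIMSEQ_le) (use X less_imp_le in blast)
  then have qx: "q x \<le> q y" for y using mq[of y] by simp
  show ?thesis
  proof (intro exI[of _ x] allI)
    fix h
    define D where "D = inner x h - \<phi> h"
    show "inner x h = \<phi> h"
    proof (cases "h = 0")
      case True then show ?thesis by (simp add: zero)
    next
      case False
      define t where "t = - D / (norm h)\<^sup>2"
      have "q (x + t *\<^sub>R h) = q x + t * D + t\<^sup>2 * (norm h)\<^sup>2 / 2"
        unfolding q_def D_def power2_norm_eq_inner scaleR add
        by (simp add: inner_simps inner_commute field_simps power2_eq_square)
      then have "0 \<le> t * D + t\<^sup>2 * (norm h)\<^sup>2 / 2"
        using qx[of "x + t *\<^sub>R h"] by simp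
      also have "\<dots> = - (D\<^sup>2 / (2 * (norm h)\<^sup>2))"
        using False by (simp add: t_def field_simps power2_eq_square)
      finally have "D\<^sup>2 / (2 * (norm h)\<^sup>2) \<le> 0" by simp
      then have "D = 0" using False
        by (simp add: divide_le_0_iff)
      then show ?thesis by (simp add: D_def)
    qed
  qed
qed

lemma Im_cinner: "Im (cinner x y) = inner x ((- \<i>) *\<^sub>C (y :: 'a::chilbert))"
  using Re_cinner[of x "(- \<i>) *\<^sub>C y"] by (simp add: cinner_scaleC_right)

lemma cinner_add_left: "cinner (x + y) z = cinner x z + cinner (y :: 'a::chilbert) z"
  by (metis cinner_add_right cinner_commute complex_cnj_add)

lemma cinner_scaleC_left: "cinner (c *\<^sub>C x) y = cnj c * cinner (x :: 'a::chilbert) y"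
  by (metis cinner_scaleC_right cinner_commute complex_cnj_mult)

lemma cinner_eqI: "(\<And>v. cinner x v = cinner y v) \<Longrightarrow> x = (y :: 'a::chilbert)"
proof -
  assume *: "\<And>v. cinner x v = cinner y v"
  have "inner x v = inner y v" for v
    using *[of v] Re_cinner by metis
  then have "inner (x - y) (x - y) = 0" by (simp add: inner_diff_left)
  then show ?thesis by simp
qed

lemma cinner_adj_left: "cinner (app (adj T) u) v = cinner u (app T v)"
proof -
  interpret T: bounded_linear "app T" by (rule bounded_linear_app)
  have "\<exists>z. \<forall>v. cinner z v = cinner u (app T v)" for u
  proof -
    have "bounded_linear (\<lambda>v. inner u (app T v))"
      using bounded_linear_compose[OF bounded_linear_inner_right bounded_linear_app] .
    from riesz_real[OF this] obtain z where z: "\<And>v. inner z v = inner u (app T v)" by blast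
    have "cinner z v = cinner u (app T v)" for v
      by (rule complex_eqI) (simp_all add: Re_cinner Im_cinner z app_scaleC)
    then show ?thesis by blast
  qed
  then obtain s where s: "\<And>u v. cinner (s u) v = cinner u (app T v)" by metis
  obtain K where K: "K > 0" "\<And>x. norm (app T x) \<le> norm x * K"
    using T.pos_bounded by blast
  have C: "s (c *\<^sub>C x) = c *\<^sub>C s x" for c x
    by (rule cinner_eqI) (simp add: s cinner_scaleC_left)
  have "bounded_linear s"
  proof (rule bounded_linear_intro[of _ K])
    show "s (x + y) = s x + s y" for x y
      by (rule cinner_eqI) (simp add: s cinner_add_left)
    show "s (r *\<^sub>R x) = r *\<^sub>R s x" for r x
      by (simp add: scaleR_scaleC C)
    show "norm (s x) \<le> norm x * K" for x
    proof -
      have "(norm (s x))\<^sup>2 = inner (s x) (s x)" by (simp add: power2_norm_eq_inner)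
      also have "\<dots> = inner x (app T (s x))" by (metis s Re_cinner)
      also have "\<dots> \<le> norm x * (norm (s x) * K)"
        using norm_cauchy_schwarz[of x "app T (s x)"] mult_left_mono[OF K(2)[of "s x"] norm_ge_zero[of x]]
        by linarith
      finally have "norm (s x) * norm (s x) \<le> norm (s x) * (norm x * K)"
        by (simp add: power2_eq_square mult_ac)
      then show ?thesis
        using K(1) by (cases "norm (s x) = 0") (auto simp: mult_le_cancel_left)
    qed
  qed
  with C have S: "app (Bop s) = s" by (simp add: Bop_inverse)
  have "\<forall>u v. cinner (app (adj T) u) v = cinner u (app T v)"
    unfolding adj_def
  proof (rule theI)
    show "\<forall>u v. cinner (app (Bop s) u) v = cinner u (app T v)" by (simp add: S s)
    fix R assume R: "\<forall>u v. cinner (app R u) v = cinner u (app T v)"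
    show "R = Bop s"
      by (rule bop_eqI, rule cinner_eqI) (simp add: S s R)
  qed
  then show ?thesis by blast
qed

abbreviation self_adjoint :: "'h::chilbert bop \<Rightarrow> bool" where
  "self_adjoint T \<equiv> adj T = T"

definition positive_op :: "'h::chilbert bop \<Rightarrow> bool" where
  "positive_op T \<longleftrightarrow> (\<forall>v. cinner v (app T v) \<in> \<real>\<^sub>\<ge>\<^sub>0)"

definition op_le :: "'h::chilbert bop \<Rightarrow> 'h bop \<Rightarrow> bool"  (infix \<open>\<sqsubseteq>\<close> 50) where
  "S \<sqsubseteq> T \<longleftrightarrow> positive_op (T - S)"

definition linear_on :: "'a::complex_vector set \<Rightarrow> ('a \<Rightarrow> 'b::complex_vector) \<Rightarrow> bool" where
  "linear_on A f \<longleftrightarrow> (\<forall>a\<in>A. \<forall>b\<in>A. f (a + b) = f a + f b) \<and> (\<forall>c. \<forall>a\<in>A. f (c *\<^sub>C a) = c *\<^sub>C f a)"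

definition ultraweak :: "'h::chilbert bop topology" where
  "ultraweak = topology_generated_by
     {{T. (\<Sum>n. cinner (u n) (app T (v n))) \<in> U} | (u :: nat \<Rightarrow> 'h) (v :: nat \<Rightarrow> 'h) U.
        summable (\<lambda>n. (norm (u n))\<^sup>2) \<and> summable (\<lambda>n. (norm (v n))\<^sup>2) \<and> open U}"


section \<open>The Hilbert space of square summable families\<close>

text \<open>The type \<open>('i, complex) l2\<close> is the usual sequence space over the index type, and
  \<open>('i, 'h) l2\<close> is the Hilbert space tensor product of \<open>'h\<close> with it, the elementary
  tensors being given by \<open>tensor_vec\<close> below.\<close>

typedef (overloaded) ('i, 'h) l2 =
  "{f :: 'i \<Rightarrow> 'h::chilbert. (\<lambda>i. (norm (f i))\<^sup>2) summable_on UNIV}"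
  morphisms coord L2
  by (rule exI[of _ "\<lambda>_. 0"]) simp

setup_lifting type_definition_l2

lemma coord_summable: "(\<lambda>i. (norm (coord f i))\<^sup>2) summable_on UNIV"
  using coord[of f] by simp

lemma l2_eqI: "(\<And>i. coord f i = coord g i) \<Longrightarrow> f = g"
  by (metis coord_inject ext)

lemma norm_add_sq: "(norm (x + y))\<^sup>2 \<le> 2 * (norm x)\<^sup>2 + 2 * (norm (y :: 'a::real_normed_vector))\<^sup>2"
proof -
  have "(norm (x + y))\<^sup>2 \<le> (norm x + norm y)\<^sup>2"
    by (intro power_mono norm_triangle_ineq) simp
  moreover have "0 \<le> (norm x - norm y)\<^sup>2" by simp
  ultimately show ?thesis by (simp add: power2_sum power2_diff)
qed

lemma l2_add:
  fixes f g :: "'i \<Rightarrow> 'h::chilbert"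
  assumes "(\<lambda>i. (norm (f i))\<^sup>2) summable_on UNIV" "(\<lambda>i. (norm (g i))\<^sup>2) summable_on UNIV"
  shows "(\<lambda>i. (norm (f i + g i))\<^sup>2) summable_on UNIV"
  by (rule summable_on_comparison_test[of "\<lambda>i. 2 * (norm (f i))\<^sup>2 + 2 * (norm (g i))\<^sup>2"])
     (auto intro!: summable_on_add summable_on_cmult_right assms norm_add_sq)

lemma l2_product:
  fixes f g :: "'i \<Rightarrow> 'h::chilbert"
  assumes "(\<lambda>i. (norm (f i))\<^sup>2) summable_on UNIV" "(\<lambda>i. (norm (g i))\<^sup>2) summable_on UNIV"
  shows "(\<lambda>i. norm (f i) * norm (g i)) summable_on UNIV"
proof (rule summable_on_comparison_test[of "\<lambda>i. (norm (f i))\<^sup>2 + (norm (g i))\<^sup>2"])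
  show "norm (f i) * norm (g i) \<le> (norm (f i))\<^sup>2 + (norm (g i))\<^sup>2" for i
    using zero_le_power2[of "norm (f i) - norm (g i)"] zero_le_power2[of "norm (f i)"]
      zero_le_power2[of "norm (g i)"]
    unfolding power2_diff by linarith
qed (auto intro!: summable_on_add assms)

lemma l2_cinner_summable: "(\<lambda>i. cinner (coord f i) (coord g i)) summable_on UNIV"
  by (rule abs_summable_summable)
     (rule Infinite_Sum.abs_summable_on_comparison_test'[OF l2_product[OF coord_summable coord_summable]],
       rule cinner_norm_bound)

lemma l2_inner_summable: "(\<lambda>i. inner (coord f i) (coord g i)) summable_on UNIV"
  using summable_on_Re[OF l2_cinner_summable[of f g]] by (simp add: Re_cinner)

instantiation l2 :: (type, chilbert) complex_vector
begin
lift_definition zero_l2 :: "('a, 'b) l2" is "\<lambda>_. 0" by simp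
lift_definition plus_l2 :: "('a, 'b) l2 \<Rightarrow> ('a, 'b) l2 \<Rightarrow> ('a, 'b) l2" is "\<lambda>f g i. f i + g i"
  by (rule l2_add)
lift_definition uminus_l2 :: "('a, 'b) l2 \<Rightarrow> ('a, 'b) l2" is "\<lambda>f i. - f i" by simp
lift_definition minus_l2 :: "('a, 'b) l2 \<Rightarrow> ('a, 'b) l2 \<Rightarrow> ('a, 'b) l2" is "\<lambda>f g i. f i - g i"
  subgoal for f g using l2_add[of f "\<lambda>i. - g i"] by simp
  done
lift_definition scaleR_l2 :: "real \<Rightarrow> ('a, 'b) l2 \<Rightarrow> ('a, 'b) l2" is "\<lambda>r f i. r *\<^sub>R f i"
  by (simp add: power_mult_distrib summable_on_cmult_right)
lift_definition scaleC_l2 :: "complex \<Rightarrow> ('a, 'b) l2 \<Rightarrow> ('a, 'b) l2" is "\<lambda>c f i. c *\<^sub>C f i"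
  by (simp add: norm_scaleC power_mult_distrib summable_on_cmult_right)
instance
  by standard
     (auto intro!: l2_eqI simp: zero_l2.rep_eq plus_l2.rep_eq uminus_l2.rep_eq minus_l2.rep_eq
       scaleR_l2.rep_eq scaleC_l2.rep_eq scaleR_add_right scaleR_add_left scaleC_add_right
       scaleC_add_left scaleC_scaleC scaleR_scaleC)
end

instantiation l2 :: (type, chilbert) real_inner
begin
definition inner_l2 :: "('a, 'b) l2 \<Rightarrow> ('a, 'b) l2 \<Rightarrow> real" where
  "inner_l2 f g = (\<Sum>\<^sub>\<infinity>i. inner (coord f i) (coord g i))"
definition norm_l2 :: "('a, 'b) l2 \<Rightarrow> real" where "norm_l2 f = sqrt (inner f f)"
definition dist_l2 :: "('a, 'b) l2 \<Rightarrow> ('a, 'b) l2 \<Rightarrow> real" where "dist_l2 f g = norm (f - g)"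
definition sgn_l2 :: "('a, 'b) l2 \<Rightarrow> ('a, 'b) l2" where "sgn_l2 f = inverse (norm f) *\<^sub>R f"
definition uniformity_l2 :: "(('a, 'b) l2 \<times> ('a, 'b) l2) filter" where
  "uniformity_l2 = (INF e\<in>{0<..}. principal {(x, y). dist x y < e})"
definition open_l2 :: "('a, 'b) l2 set \<Rightarrow> bool" where
  "open_l2 U \<longleftrightarrow> (\<forall>x\<in>U. eventually (\<lambda>(x', y). x' = x \<longrightarrow> y \<in> U) uniformity)"
instance
proof
  fix x y z :: "('a, 'b) l2" and r :: real
  show "dist x y = norm (x - y)" by (simp add: dist_l2_def)
  show "sgn x = inverse (norm x) *\<^sub>R x" by (simp add: sgn_l2_def)
  show "uniformity = (INF e\<in>{0<..}. principal {(x, y :: ('a, 'b) l2). dist x y < e})"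
    by (simp add: uniformity_l2_def)
  show "open U \<longleftrightarrow> (\<forall>x\<in>U. eventually (\<lambda>(x', y). x' = x \<longrightarrow> y \<in> U) uniformity)"
    for U :: "('a, 'b) l2 set" by (simp add: open_l2_def)
  show "inner x y = inner y x" by (simp add: inner_l2_def inner_commute)
  show "inner (x + y) z = inner x z + inner y z"
    by (simp add: inner_l2_def plus_l2.rep_eq inner_add_left infsum_add l2_inner_summable)
  show "inner (r *\<^sub>R x) y = r * inner x y"
    by (simp add: inner_l2_def scaleR_l2.rep_eq infsum_cmult_right')
  show "0 \<le> inner x x" by (simp add: inner_l2_def infsum_nonneg)
  show "inner x x = 0 \<longleftrightarrow> x = 0"
  proof
    assume "inner x x = 0"
    then have "inner (coord x i) (coord x i) = 0" for i
      using nonneg_infsum_le_0D[of "\<lambda>i. inner (coord x i) (coord x i)" UNIV i]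
      by (simp add: inner_l2_def l2_inner_summable)
    then show "x = 0" by (intro l2_eqI) (simp add: zero_l2.rep_eq)
  qed (simp add: inner_l2_def zero_l2.rep_eq)
  show "norm x = sqrt (inner x x)" by (simp add: norm_l2_def)
qed
end

lemma norm_l2_sq: "(norm f)\<^sup>2 = (\<Sum>\<^sub>\<infinity>i. (norm (coord f i))\<^sup>2)"
  by (simp add: power2_norm_eq_inner inner_l2_def)

lemma sum_le_norm_l2: "finite F \<Longrightarrow> (\<Sum>i\<in>F. (norm (coord f i))\<^sup>2) \<le> (norm f)\<^sup>2"
  unfolding norm_l2_sq by (rule finite_sum_le_infsum) (auto intro: coord_summable)

lemma norm_coord_le: "norm (coord f i) \<le> norm f"
  by (rule power2_le_imp_le) (use sum_le_norm_l2[of "{i}" f] in simp_all)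

instance l2 :: (type, chilbert) complete_space
proof
  fix X :: "nat \<Rightarrow> ('a, 'b) l2" assume X: "Cauchy X"
  have "Cauchy (\<lambda>n. coord (X n) i)" for i
  proof (rule metric_CauchyI)
    fix e :: real assume "e > 0"
    then obtain N where N: "\<forall>m\<ge>N. \<forall>n\<ge>N. dist (X m) (X n) < e"
      using X metric_CauchyD by blast
    have "dist (coord (X m) i) (coord (X n) i) \<le> dist (X m) (X n)" for m n
      using norm_coord_le[of "X m - X n" i] by (simp add: dist_norm minus_l2.rep_eq)
    then show "\<exists>M. \<forall>m\<ge>M. \<forall>n\<ge>M. dist (coord (X m) i) (coord (X n) i) < e"
      using N by (meson le_less_trans)
  qed
  then have "\<exists>l. (\<lambda>n. coord (X n) i) \<longlonglongrightarrow> l" for i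
    using Cauchy_convergent convergent_def by blast
  then obtain g where g: "\<And>i. (\<lambda>n. coord (X n) i) \<longlonglongrightarrow> g i" by metis
  have fin: "\<exists>N. \<forall>n\<ge>N. \<forall>F. finite F \<longrightarrow> (\<Sum>i\<in>F. (norm (coord (X n) i - g i))\<^sup>2) \<le> e\<^sup>2"
    if e: "e > 0" for e
  proof -
    obtain N where N: "\<forall>m\<ge>N. \<forall>n\<ge>N. dist (X m) (X n) < e"
      using X e metric_CauchyD by blast
    show ?thesis
    proof (intro exI[of _ N] allI impI)
      fix n and F :: "'a set" assume n: "n \<ge> N" and F: "finite F"
      show "(\<Sum>i\<in>F. (norm (coord (X n) i - g i))\<^sup>2) \<le> e\<^sup>2"
      proof (rule LIMSEQ_le_const2)
        show "(\<lambda>k. \<Sum>i\<in>F. (norm (coord (X n) i - coord (X k) i))\<^sup>2)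
            \<longlonglongrightarrow> (\<Sum>i\<in>F. (norm (coord (X n) i - g i))\<^sup>2)"
          by (intro tendsto_intros g)
        have "(\<Sum>i\<in>F. (norm (coord (X n) i - coord (X k) i))\<^sup>2) \<le> e\<^sup>2" if "k \<ge> N" for k
        proof -
          have "(\<Sum>i\<in>F. (norm (coord (X n) i - coord (X k) i))\<^sup>2) \<le> (dist (X n) (X k))\<^sup>2"
            using sum_le_norm_l2[OF F, of "X n - X k"] by (simp add: dist_norm minus_l2.rep_eq)
          also have "\<dots> \<le> e\<^sup>2"
            using N n that by (intro power_mono) (auto intro: less_imp_le)
          finally show ?thesis .
        qed
        then show "\<exists>K. \<forall>k\<ge>K. (\<Sum>i\<in>F. (norm (coord (X n) i - coord (X k) i))\<^sup>2) \<le> e\<^sup>2"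
          by blast
      qed
    qed
  qed
  have l2diff: "(\<lambda>i. (norm (coord (X n) i - g i))\<^sup>2) summable_on UNIV"
    if "\<forall>F. finite F \<longrightarrow> (\<Sum>i\<in>F. (norm (coord (X n) i - g i))\<^sup>2) \<le> e\<^sup>2" for n e
    by (rule nonneg_bdd_above_summable_on) (use that in \<open>auto intro!: bdd_aboveI2\<close>)
  obtain N1 where "\<forall>F. finite F \<longrightarrow> (\<Sum>i\<in>F. (norm (coord (X N1) i - g i))\<^sup>2) \<le> 1\<^sup>2"
    using fin[of 1] by auto
  from l2diff[OF this] have "(\<lambda>i. (norm (g i - coord (X N1) i))\<^sup>2) summable_on UNIV"
    by (simp add: norm_minus_commute)
  from l2_add[OF this coord_summable[of "X N1"]]
  have gl2: "(\<lambda>i. (norm (g i))\<^sup>2) summable_on UNIV" by simp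
  define G where "G = L2 g"
  have G: "coord G = g" unfolding G_def using gl2 by (simp add: L2_inverse)
  have "X \<longlonglongrightarrow> G"
  proof (rule metric_LIMSEQ_I)
    fix e :: real assume e: "e > 0"
    then obtain N where
      N: "\<forall>n\<ge>N. \<forall>F. finite F \<longrightarrow> (\<Sum>i\<in>F. (norm (coord (X n) i - g i))\<^sup>2) \<le> (e/2)\<^sup>2"
      using fin[of "e/2"] by auto
    have "dist (X n) G < e" if "n \<ge> N" for n
    proof -
      have "(norm (X n - G))\<^sup>2 \<le> (e/2)\<^sup>2"
        unfolding norm_l2_sq
        by (rule infsum_le_finite_sums) (use N that coord_summable[of "X n - G"] in \<open>auto simp: minus_l2.rep_eq G\<close>)
      then have "norm (X n - G) \<le> e/2"
        using e power2_le_imp_le[of "norm (X n - G)" "e/2"] by simp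
      then show ?thesis using e by (simp add: dist_norm)
    qed
    then show "\<exists>no. \<forall>n\<ge>no. dist (X n) G < e" by blast
  qed
  then show "convergent X" by (rule convergentI)
qed

instantiation l2 :: (type, chilbert) chilbert
begin
definition cinner_l2 :: "('a, 'b) l2 \<Rightarrow> ('a, 'b) l2 \<Rightarrow> complex" where
  "cinner_l2 f g = (\<Sum>\<^sub>\<infinity>i. cinner (coord f i) (coord g i))"
instance
proof
  fix x y z :: "('a, 'b) l2" and c :: complex
  show "cinner x y = cnj (cinner y x)"
    unfolding cinner_l2_def infsum_cnj[symmetric] by (metis cinner_commute)
  show "cinner x (y + z) = cinner x y + cinner x z"
    by (simp add: cinner_l2_def plus_l2.rep_eq cinner_add_right infsum_add l2_cinner_summable)
  show "cinner x (c *\<^sub>C y) = c * cinner x y"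
    by (simp add: cinner_l2_def scaleC_l2.rep_eq cinner_scaleC_right infsum_cmult_right')
  show "Re (cinner x y) = inner x y"
    by (simp add: cinner_l2_def inner_l2_def infsum_Re[symmetric] l2_cinner_summable Re_cinner)
qed
end

lift_definition l2_single :: "'i \<Rightarrow> 'h::chilbert \<Rightarrow> ('i, 'h) l2" is
  "\<lambda>i h k. if k = i then h else 0"
proof -
  fix i :: 'i and h :: 'h
  show "(\<lambda>k. (norm (if k = i then h else 0))\<^sup>2) summable_on UNIV"
    by (rule nonneg_bdd_above_summable_on)
       (auto intro!: bdd_aboveI2[of _ _ "(norm h)\<^sup>2"] simp: if_distrib[of norm] if_distrib[of "\<lambda>t. t\<^sup>2"]
         cong: if_cong)
qed

lift_definition tensor_vec :: "'h::chilbert \<Rightarrow> ('i, complex) l2 \<Rightarrow> ('i, 'h) l2" is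
  "\<lambda>h f i. f i *\<^sub>C h"
  by (simp add: norm_scaleC power_mult_distrib summable_on_cmult_left)

definition is_tensor_op ::
    "'h::chilbert bop \<Rightarrow> ('i, complex) l2 bop \<Rightarrow> ('i, 'h) l2 bop \<Rightarrow> bool" where
  "is_tensor_op b T S \<longleftrightarrow> (\<forall>h f. app S (tensor_vec h f) = tensor_vec (app b h) (app T f))"

lift_definition matrix_entry :: "'h::chilbert bop \<Rightarrow> 'i \<Rightarrow> 'i \<Rightarrow> ('i, 'h) l2 bop" is
  "\<lambda>b i j f. l2_single i (app b (coord f j))"
proof
  fix b :: "'h bop" and i j :: 'i
  let ?f = "\<lambda>f. l2_single i (app b (coord f j))"
  interpret b: bounded_linear "app b" by (rule bounded_linear_app)
  obtain K where K: "K > 0" "\<And>x. norm (app b x) \<le> norm x * K"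
    using b.pos_bounded by blast
  have ns: "norm (l2_single i h) = norm h" for h :: 'h
  proof -
    have "(norm (l2_single i h))\<^sup>2 = (\<Sum>\<^sub>\<infinity>k. (norm (if k = i then h else 0))\<^sup>2)"
      by (simp add: norm_l2_sq l2_single.rep_eq)
    also have "\<dots> = (\<Sum>\<^sub>\<infinity>k\<in>{i}. (norm (if k = i then h else 0))\<^sup>2)"
      by (rule infsum_cong_neutral) auto
    also have "\<dots> = (norm h)\<^sup>2" by simp
    finally show ?thesis by simp
  qed
  show "bounded_linear ?f"
  proof (rule bounded_linear_intro[of _ K])
    show "?f (f + g) = ?f f + ?f g" for f g
      by (rule l2_eqI) (simp add: l2_single.rep_eq plus_l2.rep_eq b.add)
    show "?f (r *\<^sub>R f) = r *\<^sub>R ?f f" for r f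
      by (rule l2_eqI) (simp add: l2_single.rep_eq scaleR_l2.rep_eq b.scaleR)
    show "norm (?f f) \<le> norm f * K" for f
      using order_trans[OF K(2) mult_right_mono[OF norm_coord_le]] K(1) by (simp add: ns)
  qed
  show "\<forall>c f. ?f (c *\<^sub>C f) = c *\<^sub>C ?f f"
    by (auto intro!: l2_eqI simp: l2_single.rep_eq scaleC_l2.rep_eq app_scaleC)
qed

text \<open>\<^term>\<open>matrix_entry 1 i j\<close>, over the scalars, is the matrix unit with a one in position
  \<open>(i, j)\<close>, and \<^term>\<open>matrix_entry b i j\<close> is the elementary tensor of \<open>b\<close> with it.\<close>

lemma is_tensor_op_matrix_entry: "is_tensor_op b (matrix_entry 1 i j) (matrix_entry b i j)"
  unfolding is_tensor_op_def
  by (auto intro!: l2_eqI simp: matrix_entry.rep_eq tensor_vec.rep_eq l2_single.rep_eq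
      one_bop.rep_eq app_scaleC)


section \<open>Tracial von Neumann algebras\<close>

definition commutant :: "'h::chilbert bop set \<Rightarrow> 'h bop set" where
  "commutant S = {T. \<forall>s\<in>S. s * T = T * s}"

definition von_neumann_algebra :: "'h::chilbert bop set \<Rightarrow> bool" where
  "von_neumann_algebra M \<longleftrightarrow> (\<forall>a\<in>M. adj a \<in> M) \<and> commutant (commutant M) = M"

inductive_set star_alg :: "'h::chilbert bop set \<Rightarrow> 'h bop set" for S where
  gen: "s \<in> S \<Longrightarrow> s \<in> star_alg S"
| add: "a \<in> star_alg S \<Longrightarrow> b \<in> star_alg S \<Longrightarrow> a + b \<in> star_alg S"
| mult: "a \<in> star_alg S \<Longrightarrow> b \<in> star_alg S \<Longrightarrow> a * b \<in> star_alg S"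
| scale: "a \<in> star_alg S \<Longrightarrow> c *\<^sub>C a \<in> star_alg S"
| star: "a \<in> star_alg S \<Longrightarrow> adj a \<in> star_alg S"

text \<open>The von Neumann tensor product of \<open>B\<close> with all bounded operators on the sequence space.\<close>

definition tensor_full :: "'h::chilbert bop set \<Rightarrow> ('i, 'h) l2 bop set" where
  "tensor_full B = commutant (commutant (star_alg {S. \<exists>b\<in>B. \<exists>T. is_tensor_op b T S}))"

definition normal_on :: "'h::chilbert bop set \<Rightarrow> ('h bop \<Rightarrow> 'k::chilbert bop) \<Rightarrow> bool" where
  "normal_on A f \<longleftrightarrow> continuous_map (subtopology ultraweak A) ultraweak f"

definition tracial_state :: "'h::chilbert bop set \<Rightarrow> ('h bop \<Rightarrow> complex) \<Rightarrow> bool" where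
  "tracial_state M \<tau> \<longleftrightarrow>
     linear_on M \<tau> \<and> \<tau> 1 = 1 \<and>
     (\<forall>a\<in>M. \<tau> (adj a * a) \<in> \<real>\<^sub>\<ge>\<^sub>0) \<and>
     (\<forall>a\<in>M. \<forall>b\<in>M. \<tau> (a * b) = \<tau> (b * a))"

definition tracial_von_neumann_algebra :: "'h::chilbert bop set \<Rightarrow> ('h bop \<Rightarrow> complex) \<Rightarrow> bool" where
  "tracial_von_neumann_algebra M \<tau> \<longleftrightarrow>
     von_neumann_algebra M \<and> tracial_state M \<tau> \<and>
     (\<forall>a\<in>M. \<tau> (adj a * a) = 0 \<longrightarrow> a = 0) \<and>
     continuous_map (subtopology ultraweak M) euclidean \<tau>"

text \<open>The GNS space is the completion of \<open>M\<close> for the inner product given by the trace: it is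
  specified by a Hilbert space together with the canonical map \<open>\<Lambda>\<close> of \<open>M\<close> onto a dense
  subspace, which determines it up to unique unitary equivalence.\<close>

definition gns_space ::
    "'h::chilbert bop set \<Rightarrow> ('h bop \<Rightarrow> complex) \<Rightarrow> ('h bop \<Rightarrow> 'l::chilbert) \<Rightarrow> bool" where
  "gns_space M \<tau> \<Lambda> \<longleftrightarrow>
     linear_on M \<Lambda> \<and>
     (\<forall>a\<in>M. \<forall>b\<in>M. cinner (\<Lambda> a) (\<Lambda> b) = \<tau> (adj a * b)) \<and>
     closure (\<Lambda> ` M) = UNIV"

text \<open>There is exactly one such map on \<open>M\<close>; its values off \<open>M\<close> are irrelevant throughout.\<close>

definition trace_preserving_expectation ::
    "'h::chilbert bop set \<Rightarrow> 'h bop set \<Rightarrow> ('h bop \<Rightarrow> complex) \<Rightarrow> ('h bop \<Rightarrow> 'h bop) \<Rightarrow> bool" where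
  "trace_preserving_expectation M B \<tau> E \<longleftrightarrow>
     (\<forall>a\<in>M. E a \<in> B) \<and> linear_on M E \<and>
     (\<forall>b\<in>B. E b = b) \<and>
     (\<forall>a\<in>M. \<forall>b\<in>B. \<forall>c\<in>B. E (b * a * c) = b * E a * c) \<and>
     (\<forall>a\<in>M. positive_op (E (adj a * a))) \<and>
     (\<forall>a\<in>M. E (adj a * a) = 0 \<longrightarrow> a = 0) \<and>
     normal_on M E \<and>
     (\<forall>a\<in>M. \<tau> (E a) = \<tau> a)"

definition no_atoms_in :: "'h::chilbert bop set \<Rightarrow> 'h bop \<Rightarrow> bool" where
  "no_atoms_in B x \<longleftrightarrow> (\<forall>b\<in>B. self_adjoint b \<longrightarrow> {v. app (x - b) v = 0} = {0})"


section \<open>Covariance matrices and conjugate systems\<close>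

text \<open>An \<open>n \<times> n\<close> matrix of operators on a Hilbert space, viewed as an operator on the \<open>n\<close>-fold
  direct sum, is positive.\<close>

definition positive_matrix :: "nat \<Rightarrow> (nat \<Rightarrow> nat \<Rightarrow> 'h::chilbert bop) \<Rightarrow> bool" where
  "positive_matrix n T \<longleftrightarrow>
     (\<forall>v. (\<Sum>k<n. \<Sum>l<n. cinner (v k) (app (T k l) (v l))) \<in> \<real>\<^sub>\<ge>\<^sub>0)"

definition completely_positive_on ::
    "'h::chilbert bop set \<Rightarrow> ('h bop \<Rightarrow> 'k::chilbert bop) \<Rightarrow> bool" where
  "completely_positive_on B \<Phi> \<longleftrightarrow> linear_on B \<Phi> \<and>
     (\<forall>n b. (\<forall>k<n. \<forall>l<n. b k l \<in> B) \<and> positive_matrix n b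
        \<longrightarrow> positive_matrix n (\<lambda>k l. \<Phi> (b k l)))"

text \<open>The family \<open>\<eta>\<close> consists of the entries of the map \<open>\<Phi>\<close>, which it determines on \<open>B\<close>.  The
  double series converges in the sense of the finite square truncations; unconditional
  convergence over arbitrary finite sets of pairs of indices would fail for general matrices
  of bounded operators.\<close>

definition covariance_matrix ::
    "'h::chilbert bop set \<Rightarrow> ('i \<Rightarrow> 'i \<Rightarrow> 'h bop \<Rightarrow> 'h bop) \<Rightarrow> bool" where
  "covariance_matrix B \<eta> \<longleftrightarrow>
     (\<forall>i j. linear_on B (\<eta> i j) \<and> (\<forall>b\<in>B. \<eta> i j b \<in> B)) \<and>
     (\<exists>\<Phi> :: 'h bop \<Rightarrow> ('i, 'h) l2 bop.
        (\<forall>b\<in>B. \<Phi> b \<in> tensor_full B) \<and>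
        normal_on B \<Phi> \<and> completely_positive_on B \<Phi> \<and>
        (\<forall>b\<in>B. limitin ultraweak (\<lambda>F. \<Sum>i\<in>F. \<Sum>j\<in>F. matrix_entry (\<eta> i j b) i j) (\<Phi> b)
                 (finite_subsets_at_top UNIV)))"

definition trace_symmetric ::
    "'h::chilbert bop set \<Rightarrow> ('h bop \<Rightarrow> complex) \<Rightarrow> ('i \<Rightarrow> 'i \<Rightarrow> 'h bop \<Rightarrow> 'h bop) \<Rightarrow> bool" where
  "trace_symmetric B \<tau> \<eta> \<longleftrightarrow>
     (\<forall>i j. \<forall>a\<in>B. \<forall>b\<in>B. \<tau> (\<eta> i j a * b) = \<tau> (a * \<eta> j i b))"

definition extend_cov ::
    "('h::chilbert bop \<Rightarrow> 'h bop) \<Rightarrow> ('i \<Rightarrow> 'i \<Rightarrow> 'h bop \<Rightarrow> 'h bop) \<Rightarrow> 'i \<Rightarrow> 'i \<Rightarrow> 'h bop \<Rightarrow> 'h bop" where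
  "extend_cov E \<eta> i j a = \<eta> i j (E a)"

text \<open>\<open>word x j b k l\<close> is \<open>b k * x (j (k + 1)) * b (k + 1) * \<dots> * x (j l) * b l\<close>.\<close>

definition word ::
    "('i \<Rightarrow> 'h::chilbert bop) \<Rightarrow> (nat \<Rightarrow> 'i) \<Rightarrow> (nat \<Rightarrow> 'h bop) \<Rightarrow> nat \<Rightarrow> nat \<Rightarrow> 'h bop" where
  "word x j b k l = b k * prod_list (map (\<lambda>r. x (j r) * b r) [Suc k..<Suc l])"

definition conjugate_variable ::
    "'h::chilbert bop set \<Rightarrow> ('h bop \<Rightarrow> complex) \<Rightarrow> ('h bop \<Rightarrow> 'h bop) \<Rightarrow> ('h bop \<Rightarrow> 'l::chilbert) \<Rightarrow>
     ('i \<Rightarrow> 'i \<Rightarrow> 'h bop \<Rightarrow> 'h bop) \<Rightarrow> ('i \<Rightarrow> 'h bop) \<Rightarrow> 'i \<Rightarrow> 'l \<Rightarrow> bool" where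
  "conjugate_variable B \<tau> E \<Lambda> \<eta> x i \<xi> \<longleftrightarrow>
     (\<forall>d j b. (\<forall>k\<le>d. b k \<in> B) \<longrightarrow>
        cinner \<xi> (\<Lambda> (word x j b 0 d)) =
          (\<Sum>k=1..d. \<tau> (extend_cov E \<eta> i (j k) (word x j b 0 (k - 1)) * E (word x j b k d))))"

definition conjugate_system ::
    "'h::chilbert bop set \<Rightarrow> ('h bop \<Rightarrow> complex) \<Rightarrow> ('h bop \<Rightarrow> 'h bop) \<Rightarrow> ('h bop \<Rightarrow> 'l::chilbert) \<Rightarrow>
     ('i \<Rightarrow> 'i \<Rightarrow> 'h bop \<Rightarrow> 'h bop) \<Rightarrow> ('i \<Rightarrow> 'h bop) \<Rightarrow> ('i \<Rightarrow> 'l) \<Rightarrow> bool" where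
  "conjugate_system B \<tau> E \<Lambda> \<eta> x \<xi> \<longleftrightarrow> (\<forall>i. conjugate_variable B \<tau> E \<Lambda> \<eta> x i (\<xi> i))"

end

theory Submission
  imports Defs
begin

text \<open>
  Put \<open>T = \<Sum>\<^sub>j a\<^sub>j b\<^sub>j\<close>, where in the second part only the terms with the letter \<open>x\<^sub>i\<close> count.  An
  atom of \<open>P\<close> in \<open>B\<close> is a kernel of some \<open>P - s\<close>, which has the same form with another \<open>b\<^sub>0\<close>, so
  it suffices that \<open>P\<close> has no kernel.  Pairing with the conjugate variable \<open>\<xi> = \<xi>\<^sub>i\<close>
  applies a derivation \<open>\<partial>\<close> and then the expectation and the trace, and
  \<open>\<partial>P = \<Sum>\<^sub>j a\<^sub>j \<otimes> b\<^sub>j\<close> has coefficients in \<open>B\<close>.  With \<open>\<Psi>(l, r) = \<tau>(E(l) T E(r))\<close>, a bounded form on \<open>L\<^sup>2\<close>, the Leibniz rule reads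
  \<open>\<langle>\<xi>, S\<^sup>N\<rangle> = z \<Sum>\<^sub>k \<Psi>(S\<^sup>k, S\<^sup>N\<^sup>-\<^sup>1\<^sup>-\<^sup>k)\<close> for every affine function \<open>S = z P + u\<close>
  (\<open>conjugate_variable_power\<close>).

  A resolvent of \<open>P\<close> has an elementary tensor as its difference quotient.
  For \<open>g = \<epsilon> (P + i\<epsilon>)\<^sup>-\<^sup>1\<close> the derivation gives \<open>\<epsilon> \<langle>\<xi>, g\<rangle> = - \<Psi>(g, g)\<close>
  (\<open>conjugate_resolvent\<close>).  As \<open>\<epsilon>\<close> tends to zero the left hand side vanishes, since \<open>g\<close> stays
  bounded, while \<open>g\<close> tends to \<open>- i w\<close> with the projection \<open>w\<close> onto the kernel of \<open>P\<close>.  In the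
  limit \<open>0 = \<tau>(E(w) T E(w)) \<ge> c \<tau>(w)\<^sup>2\<close>, so \<open>w = 0\<close> because the trace is faithful.

  The limit is carried out without strong convergence.  In \<open>g = X - i y\<close> with
  \<open>y = \<epsilon>\<^sup>2 (P\<^sup>2 + \<epsilon>\<^sup>2)\<^sup>-\<^sup>1\<close> one has \<open>y \<ge> w\<close>, hence \<open>\<Psi>(y, y) \<ge> c \<tau>(w)\<^sup>2\<close>
  (\<open>kernel_trace_estimate\<close>), and the \<open>L\<^sup>2\<close> norm of \<open>X\<close> is controlled by the drop of \<open>\<tau>(y)\<close> when
  \<open>\<epsilon>\<close> is halved (\<open>resolvent_trace_decrease\<close>).  Such drops tend to zero, because \<open>\<tau>(y)\<close>
  decreases and is nonnegative.
\<close>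

section \<open>Algebra of bounded operators\<close>

lemmas app_simps = plus_bop.rep_eq zero_bop.rep_eq uminus_bop.rep_eq minus_bop.rep_eq
  times_bop.rep_eq one_bop.rep_eq scaleR_bop.rep_eq scaleC_bop.rep_eq

lemma app_add: "app T (u + v) = app T u + app T v"
  and app_diff: "app T (u - v) = app T u - app T v"
  and app_zero: "app T 0 = 0"
  using bounded_linear_app[of T] by (simp_all add: linear_simps)

lemma scaleC_minus_left: "(- c) *\<^sub>C x = - (c *\<^sub>C (x :: 'a::complex_vector))"
  using scaleC_add_left[of c "- c" x] by (simp add: eq_neg_iff_add_eq_0 add.commute)

lemma scaleC_diff_left: "(c - d) *\<^sub>C x = c *\<^sub>C x - d *\<^sub>C (x :: 'a::complex_vector)"
  using scaleC_add_left[of c "- d" x] by (simp add: scaleC_minus_left)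

lemma scaleC_sum_right: "c *\<^sub>C (\<Sum>t\<in>J. f t) = (\<Sum>t\<in>J. c *\<^sub>C (f t :: 'a::complex_vector))"
  by (induction J rule: infinite_finite_induct) (simp_all add: scaleC_add_right)

lemma scaleC_mult_left: "(c *\<^sub>C a) * b = c *\<^sub>C (a * (b :: 'h::chilbert bop))"
  and scaleC_mult_right: "a * (c *\<^sub>C b) = c *\<^sub>C (a * b)"
  by (auto intro!: bop_eqI simp: app_simps app_scaleC)

lemma cinner_diff_right: "cinner x (y - z) = cinner x y - cinner (x :: 'a::chilbert) z"
  using cinner_add_right[of x "y - z" z] by simp

lemma cinner_diff_left: "cinner (x - y) z = cinner x z - cinner (y :: 'a::chilbert) z"
  using cinner_add_left[of "x - y" y z] by simp

lemma cinner_zero_left [simp]: "cinner 0 x = 0"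
  using cinner_diff_left[of 0 0 x] by simp

lemma cinner_adj_right: "cinner u (app (adj T) v) = cinner (app T u) v"
  by (metis cinner_adj_left cinner_commute)

lemma adj_unique: "(\<And>u v. cinner (app S u) v = cinner u (app T v)) \<Longrightarrow> adj T = S"
  by (rule bop_eqI, rule cinner_eqI) (simp add: cinner_adj_left)

lemma adj_adj [simp]: "adj (adj T) = T"
  by (rule adj_unique) (simp add: cinner_adj_right)

lemma adj_one [simp]: "adj 1 = 1"
  by (rule adj_unique) (simp add: app_simps)

lemma adj_add: "adj (S + T) = adj S + adj T"
  by (rule adj_unique) (simp add: app_simps cinner_adj_left cinner_add_left cinner_add_right)

lemma adj_diff: "adj (S - T) = adj S - adj T"
  by (rule adj_unique) (simp add: app_simps cinner_adj_left cinner_diff_left cinner_diff_right)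

lemma adj_mult: "adj (S * T) = adj T * adj S"
  by (rule adj_unique) (simp add: app_simps cinner_adj_left)

lemma adj_scaleC: "adj (c *\<^sub>C T) = cnj c *\<^sub>C adj T"
  by (rule adj_unique)
    (simp add: app_simps cinner_adj_left cinner_scaleC_left cinner_scaleC_right)

lemma bop_eq_zero_if_form_zero:
  assumes "\<And>v. cinner v (app k v) = 0"
  shows "k = 0"
proof (rule bop_eqI, rule cinner_eqI)
  fix u v
  have "cinner v (app k u) + cinner u (app k v) = 0"
    using assms[of "u + v"] assms[of u] assms[of v]
    by (simp add: app_add cinner_add_left cinner_add_right)
  moreover have "cinner v (app k u) * (- \<i>) + \<i> * cinner u (app k v) = 0"
    using assms[of "u + \<i> *\<^sub>C v"] assms[of u] assms[of v]
    by (simp add: app_add app_scaleC cinner_add_left cinner_add_right cinner_scaleC_left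
        cinner_scaleC_right)
  then have "\<i> * (cinner u (app k v) - cinner v (app k u)) = 0"
    by (simp add: algebra_simps)
  ultimately have "cinner v (app k u) = 0"
    by simp
  then show "cinner (app k u) v = cinner (app 0 u) v"
    using cinner_commute[of "app k u" v] by (simp add: app_simps)
qed

lemma positive_op_iff: "positive_op h \<longleftrightarrow> self_adjoint h \<and> (\<forall>v. 0 \<le> inner v (app h v))"
proof
  assume h: "positive_op h"
  have "cinner v (app (h - adj h) v) = 0" for v
  proof -
    have "cinner v (app h v) \<in> \<real>\<^sub>\<ge>\<^sub>0"
      using h by (simp add: positive_op_def)
    then have "Im (cinner v (app h v)) = 0"
      by (simp add: complex_nonneg_Reals_iff)
    moreover have "cinner v (app (adj h) v) = cnj (cinner v (app h v))"
      by (metis cinner_adj_right cinner_commute)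
    ultimately show ?thesis
      by (simp add: app_simps cinner_diff_right complex_eq_iff)
  qed
  then have "h - adj h = 0"
    by (rule bop_eq_zero_if_form_zero)
  moreover have "0 \<le> inner v (app h v)" for v
    using h by (simp add: positive_op_def complex_nonneg_Reals_iff Re_cinner[symmetric])
  ultimately show "self_adjoint h \<and> (\<forall>v. 0 \<le> inner v (app h v))"
    by simp
next
  assume h: "self_adjoint h \<and> (\<forall>v. 0 \<le> inner v (app h v))"
  have "Im (cinner v (app h v)) = 0" for v
    using h cinner_adj_left[of h v v] cinner_commute[of v "app h v"]
    by (simp add: complex_eq_iff)
  then show "positive_op h"
    using h by (simp add: positive_op_def complex_nonneg_Reals_iff Re_cinner)
qed

lemma inner_adj_left: "inner (app (adj T) u) v = inner u (app T v)"
  by (metis Re_cinner cinner_adj_left)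

lemma inner_adj_right: "inner u (app (adj T) v) = inner (app T u) v"
  by (metis Re_cinner cinner_adj_right)

lemma positive_op_add: "positive_op h \<Longrightarrow> positive_op k \<Longrightarrow> positive_op (h + k)"
  by (simp add: positive_op_iff adj_add app_simps inner_add_right)

lemma positive_op_congruence: "positive_op h \<Longrightarrow> positive_op (adj a * h * a)"
  by (simp add: positive_op_iff adj_mult mult.assoc app_simps inner_adj_right)

lemma positive_op_square: "positive_op (adj a * a)"
  by (simp add: positive_op_iff adj_mult app_simps inner_adj_right)

text \<open>The operator \<open>h - h\<^sup>2\<close> equals \<open>h (1 - h) h + (1 - h) h (1 - h)\<close>, and its complement is
  \<open>(1 - h) + h\<^sup>2\<close>.\<close>

lemma positive_op_diff_square:
  assumes "positive_op h" "positive_op (1 - h)"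
  shows "positive_op (h - h * h)" and "positive_op (1 - (h - h * h))"
proof -
  have h: "self_adjoint h"
    using assms(1) by (simp add: positive_op_iff)
  have "positive_op (adj h * (1 - h) * h + adj (1 - h) * h * (1 - h))"
    by (intro positive_op_add positive_op_congruence assms)
  also have "adj h * (1 - h) * h + adj (1 - h) * h * (1 - h) = h - h * h"
    by (simp add: h adj_diff algebra_simps)
  finally show "positive_op (h - h * h)" .
  have "positive_op ((1 - h) + adj h * h)"
    by (intro positive_op_add positive_op_square assms)
  then show "positive_op (1 - (h - h * h))"
    by (simp add: h algebra_simps)
qed

lemma positive_op_norm_diff:
  assumes "\<And>v. norm (app T v) \<le> K * norm v" and "0 \<le> K"
  shows "positive_op (complex_of_real (K\<^sup>2) *\<^sub>C 1 - adj T * T)"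
proof -
  have "0 \<le> inner v (app (complex_of_real (K\<^sup>2) *\<^sub>C 1 - adj T * T) v)" for v
  proof -
    have "(norm (app T v))\<^sup>2 \<le> (K * norm v)\<^sup>2"
      using assms by (intro power_mono) auto
    moreover have "inner v (app (complex_of_real (K\<^sup>2) *\<^sub>C 1) v) = (K * norm v)\<^sup>2"
      by (simp only: app_simps flip: scaleR_scaleC)
        (simp add: power_mult_distrib power2_norm_eq_inner)
    moreover have "inner v (app (adj T * T) v) = (norm (app T v))\<^sup>2"
      by (simp add: app_simps inner_adj_right power2_norm_eq_inner)
    ultimately show ?thesis
      by (simp only: minus_bop.rep_eq inner_diff_right)
  qed
  then show ?thesis
    by (simp add: positive_op_iff adj_diff adj_mult adj_scaleC)
qed

lemma app_bound: "\<exists>K>0. \<forall>v. norm (app T v) \<le> K * norm v"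
  using bounded_linear.pos_bounded[OF bounded_linear_app[of T]] by (metis mult.commute)


section \<open>Von Neumann algebras\<close>

lemma von_neumann_algebra_closed:
  assumes "von_neumann_algebra N"
  shows "1 \<in> N" and "0 \<in> N"
    and "a \<in> N \<Longrightarrow> b \<in> N \<Longrightarrow> a + b \<in> N"
    and "a \<in> N \<Longrightarrow> b \<in> N \<Longrightarrow> a - b \<in> N"
    and "a \<in> N \<Longrightarrow> b \<in> N \<Longrightarrow> a * b \<in> N"
    and "a \<in> N \<Longrightarrow> c *\<^sub>C a \<in> N"
    and "a \<in> N \<Longrightarrow> adj a \<in> N"
    and "a \<in> N \<Longrightarrow> a ^ n \<in> N"
proof -
  define C where "C = commutant N"
  have N: "N = {T. \<forall>s\<in>C. s * T = T * s}"
    using assms by (simp add: von_neumann_algebra_def commutant_def C_def)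
  show one: "1 \<in> N" and "0 \<in> N"
    by (simp_all add: N)
  show "a + b \<in> N" "a - b \<in> N" if "a \<in> N" "b \<in> N"
    using that by (simp_all add: N algebra_simps)
  show mult: "a * b \<in> N" if "a \<in> N" "b \<in> N" for a b
    using that by (simp add: N) (metis mult.assoc)
  show "c *\<^sub>C a \<in> N" if "a \<in> N"
    using that by (simp add: N scaleC_mult_left scaleC_mult_right)
  show "adj a \<in> N" if "a \<in> N"
    using assms that by (simp add: von_neumann_algebra_def)
  show "a ^ n \<in> N" if "a \<in> N"
    using that by (induction n) (simp_all add: one mult)
qed

lemma von_neumann_algebra_sum_closed:
  assumes "von_neumann_algebra N" "\<And>t. t \<in> J \<Longrightarrow> f t \<in> N"
  shows "(\<Sum>t\<in>J. f t) \<in> N"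
  using assms(2) by (induction J rule: infinite_finite_induct)
    (simp_all add: von_neumann_algebra_closed[OF assms(1)])

lemma von_neumann_algebra_memI:
  assumes "von_neumann_algebra N" and "\<And>s. s \<in> commutant N \<Longrightarrow> s * T = T * s"
  shows "T \<in> N"
  using assms unfolding von_neumann_algebra_def commutant_def by blast

lemma adj_commutant:
  assumes "von_neumann_algebra N" and "s \<in> commutant N"
  shows "adj s \<in> commutant N"
proof -
  have "a * adj s = adj s * a" if "a \<in> N" for a
  proof -
    have "adj a * s = s * adj a"
      using assms that by (simp add: commutant_def von_neumann_algebra_def)
    then have "adj (adj a * s) = adj (s * adj a)"
      by simp
    then show ?thesis
      by (simp add: adj_mult)
  qed
  then show ?thesis
    by (simp add: commutant_def)
qed

text \<open>The Neumann series without series: \<open>u\<close> with \<open>(1 - S) u = v\<close> is the unique fixed point of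
  the contraction \<open>u \<mapsto> v + S u\<close>.  Uniqueness makes the solution operator linear and makes it
  commute with everything that commutes with \<open>S\<close>, which puts it into the algebra.\<close>

lemma von_neumann_algebra_inverse:
  assumes N: "von_neumann_algebra N" and S: "S \<in> N"
    and \<rho>: "0 \<le> \<rho>" "\<rho> < 1" "\<And>v. norm (app S v) \<le> \<rho> * norm v"
  shows "\<exists>R\<in>N. R * (1 - S) = 1 \<and> (1 - S) * R = 1"
proof -
  have "\<exists>!u. v + app S u = u" for v
  proof -
    have "\<forall>x y. dist (v + app S x) (v + app S y) \<le> \<rho> * dist x y"
      using \<rho>(3) by (metis add_diff_cancel_left app_diff dist_norm)
    from banach_fix_type[OF \<rho>(1,2) this] show ?thesis .
  qed
  then obtain r where r: "\<And>v. v + app S (r v) = r v" and r_uniq: "\<And>v u. v + app S u = u \<Longrightarrow> r v = u"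
    by metis
  have bl: "bounded_linear r"
  proof (rule bounded_linear_intro[of _ "1 / (1 - \<rho>)"])
    show "r (x + y) = r x + r y" for x y
      using arg_cong2[OF r[of x] r[of y], of "(+)"]
      by (intro r_uniq) (simp add: app_add algebra_simps)
    show "r (s *\<^sub>R x) = s *\<^sub>R r x" for s x
      using arg_cong[OF r[of x], of "\<lambda>v. s *\<^sub>R v"]
      by (intro r_uniq) (simp add: scaleR_scaleC app_scaleC scaleC_add_right)
    show "norm (r x) \<le> norm x * (1 / (1 - \<rho>))" for x
    proof -
      have "norm (r x) \<le> norm x + norm (app S (r x))"
        by (metis r norm_triangle_ineq)
      then have "norm (r x) * (1 - \<rho>) \<le> norm x"
        using \<rho>(3)[of "r x"] by (simp add: algebra_simps)
      then show ?thesis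
        using \<rho>(2) by (simp add: field_simps)
    qed
  qed
  have "r (c *\<^sub>C x) = c *\<^sub>C r x" for c x
    using arg_cong[OF r[of x], of "\<lambda>v. c *\<^sub>C v"]
    by (intro r_uniq) (simp add: app_scaleC scaleC_add_right)
  then have R: "app (Bop r) = r"
    using bl by (simp add: Bop_inverse)
  have "Bop r \<in> N"
  proof (rule von_neumann_algebra_memI[OF N])
    fix s assume "s \<in> commutant N"
    then have "S * s = s * S"
      using S by (simp add: commutant_def)
    then have sS: "app S (app s u) = app s (app S u)" for u
      by (metis times_bop.rep_eq)
    have "r (app s v) = app s (r v)" for v
      using arg_cong[OF r[of v], of "app s"] by (intro r_uniq) (simp add: app_add sS)
    then show "s * Bop r = Bop r * s"
      by (intro bop_eqI) (simp add: app_simps R)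
  qed
  moreover have "Bop r * (1 - S) = 1"
    by (rule bop_eqI) (auto simp: app_simps R app_diff intro!: r_uniq)
  moreover have "(1 - S) * Bop r = 1"
    using r by (intro bop_eqI) (simp add: app_simps R algebra_simps)
  ultimately show ?thesis
    by blast
qed

text \<open>A minimizing sequence for the distance is Cauchy by the parallelogram law.\<close>

lemma closed_subspace_projection:
  fixes N :: "'a::{real_inner, complete_space} set"
  assumes "closed N" "subspace N"
  shows "\<exists>p\<in>N. \<forall>h\<in>N. inner (u - p) h = 0"
proof -
  define m where "m = Inf ((\<lambda>y. (norm (u - y))\<^sup>2) ` N)"
  have ne: "N \<noteq> {}"
    using assms(2) subspace_0 by blast
  have bdd: "bdd_below ((\<lambda>y. (norm (u - y))\<^sup>2) ` N)"
    by (rule bdd_belowI2[of _ 0]) simp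
  have m: "m \<le> (norm (u - y))\<^sup>2" if "y \<in> N" for y
    unfolding m_def using bdd that by (intro cInf_lower) auto
  have "\<exists>y\<in>N. (norm (u - y))\<^sup>2 < m + 1 / real (Suc n)" for n
    using cInf_lessD[of "(\<lambda>y. (norm (u - y))\<^sup>2) ` N" "m + 1 / real (Suc n)"] ne
    by (auto simp: m_def)
  then obtain X where X: "\<And>n. X n \<in> N" "\<And>n. (norm (u - X n))\<^sup>2 < m + 1 / real (Suc n)"
    by metis
  have par: "(dist x y)\<^sup>2 \<le> 2 * ((norm (u - x))\<^sup>2 - m) + 2 * ((norm (u - y))\<^sup>2 - m)"
    if "x \<in> N" "y \<in> N" for x y
  proof -
    have "(1/2) *\<^sub>R (x + y) \<in> N"
      using assms(2) that by (intro subspace_scale subspace_add)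
    from m[OF this] have "m \<le> (norm (u - (1/2) *\<^sub>R (x + y)))\<^sup>2" .
    moreover have "(dist x y)\<^sup>2 =
        2 * (norm (u - x))\<^sup>2 + 2 * (norm (u - y))\<^sup>2 - 4 * (norm (u - (1/2) *\<^sub>R (x + y)))\<^sup>2"
      unfolding dist_norm power2_norm_eq_inner by (simp add: inner_simps inner_commute field_simps)
    ultimately show ?thesis
      by simp
  qed
  have "Cauchy X"
  proof (rule metric_CauchyI)
    fix e :: real assume e: "e > 0"
    obtain K where K: "1 / real (Suc K) < e\<^sup>2 / 4"
      using e reals_Archimedean[of "e\<^sup>2 / 4"] by (auto simp: inverse_eq_divide)
    have "dist (X k) (X n) < e" if "k \<ge> K" "n \<ge> K" for k n
    proof -
      have "1 / real (Suc k) \<le> 1 / real (Suc K)" "1 / real (Suc n) \<le> 1 / real (Suc K)"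
        using that by (auto intro!: divide_left_mono)
      then have "(dist (X k) (X n))\<^sup>2 < e\<^sup>2"
        using par[OF X(1) X(1), of k n] X(2)[of k] X(2)[of n] K by argo
      then show ?thesis
        using e power2_less_imp_less[of "dist (X k) (X n)" e] by simp
    qed
    then show "\<exists>M. \<forall>m\<ge>M. \<forall>n\<ge>M. dist (X m) (X n) < e"
      by blast
  qed
  then obtain p where p: "X \<longlonglongrightarrow> p"
    using Cauchy_convergent convergent_def by blast
  have pN: "p \<in> N"
    using closed_sequentially[OF assms(1) X(1) p] .
  have "(\<lambda>n. (norm (u - X n))\<^sup>2) \<longlonglongrightarrow> (norm (u - p))\<^sup>2"
    by (intro tendsto_intros p)
  moreover have "(\<lambda>n. m + 1 / real (Suc n)) \<longlonglongrightarrow> m + 0"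
    by (intro tendsto_intros LIMSEQ_Suc lim_1_over_n)
  ultimately have "(norm (u - p))\<^sup>2 \<le> m + 0"
    by (rule LIMSEQ_le) (use X(2) less_imp_le in blast)
  then have min: "(norm (u - p))\<^sup>2 \<le> (norm (u - y))\<^sup>2" if "y \<in> N" for y
    using m[OF that] by linarith
  have "inner (u - p) h = 0" if h: "h \<in> N" for h
  proof (cases "h = 0")
    case False
    define t where "t = inner (u - p) h / (norm h)\<^sup>2"
    have "p + t *\<^sub>R h \<in> N"
      using assms(2) pN h by (intro subspace_add subspace_scale)
    from min[OF this] have "0 \<le> (norm (u - (p + t *\<^sub>R h)))\<^sup>2 - (norm (u - p))\<^sup>2"
      by simp
    also have "\<dots> = t\<^sup>2 * (norm h)\<^sup>2 - 2 * t * inner (u - p) h"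
      unfolding power2_norm_eq_inner
      by (simp add: inner_simps inner_commute algebra_simps power2_eq_square)
    also have "\<dots> = - ((inner (u - p) h)\<^sup>2 / (norm h)\<^sup>2)"
      using False by (simp add: t_def field_simps power2_eq_square)
    finally show ?thesis
      using False by (simp add: divide_le_0_iff)
  qed simp
  with pN show ?thesis
    by blast
qed

text \<open>The projection onto the kernel of an element of the algebra lies in the algebra, since the
  commutant leaves the kernel and its orthogonal complement invariant.\<close>

lemma kernel_projection:
  assumes N: "von_neumann_algebra N" and P: "P \<in> N"
  shows "\<exists>w\<in>N. self_adjoint w \<and> w * w = w \<and> P * w = 0 \<and> (\<forall>v. app P v = 0 \<longrightarrow> app w v = v)"
proof -
  define K where "K = {v. app P v = 0}"
  have cont: "continuous_on UNIV (app P)"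
    using bounded_linear.linear bounded_linear_app linear_continuous_on by blast
  have "closed K"
    using closed_vimage[OF closed_singleton[of 0] cont] by (simp add: K_def vimage_def)
  moreover have "subspace K"
    by (simp add: K_def subspace_def app_zero app_add scaleR_scaleC app_scaleC)
  ultimately have "\<exists>p\<in>K. \<forall>h\<in>K. inner (u - p) h = 0" for u
    by (rule closed_subspace_projection)
  then obtain q where q: "\<And>u. q u \<in> K" "\<And>u h. h \<in> K \<Longrightarrow> inner (u - q u) h = 0"
    by metis
  have Kc: "c *\<^sub>C h \<in> K" if "h \<in> K" for c h
    using that by (simp add: K_def app_scaleC)
  have Kd: "g - h \<in> K" "g + h \<in> K" if "g \<in> K" "h \<in> K" for g h
    using that by (simp_all add: K_def app_diff app_add)
  have qc: "cinner (u - q u) h = 0" if "h \<in> K" for u h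
    using q(2)[OF that, of u] q(2)[OF Kc[OF that], of u "- \<i>"]
    by (intro complex_eqI) (simp_all add: Re_cinner Im_cinner)
  have q_uniq: "q u = p" if "p \<in> K" "\<And>h. h \<in> K \<Longrightarrow> cinner (u - p) h = 0" for u p
  proof -
    have "cinner (q u - p) (q u - p) = cinner (u - p) (q u - p) - cinner (u - q u) (q u - p)"
      by (simp add: cinner_diff_left)
    also have "\<dots> = 0"
      using Kd(1)[OF q(1)[of u] that(1)] that(2) qc by simp
    finally show ?thesis
      by (simp add: cinner_self)
  qed
  have sc: "q (c *\<^sub>C x) = c *\<^sub>C q x" for c x
  proof (rule q_uniq)
    show "c *\<^sub>C q x \<in> K" by (rule Kc[OF q(1)])
    show "cinner (c *\<^sub>C x - c *\<^sub>C q x) h = 0" if "h \<in> K" for h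
      using qc[OF that] by (simp add: scaleC_diff_right[symmetric] cinner_scaleC_left)
  qed
  have "bounded_linear q"
  proof (rule bounded_linear_intro[of _ 1])
    show "q (x + y) = q x + q y" for x y
    proof (rule q_uniq)
      show "q x + q y \<in> K" using Kd q(1) by blast
      show "cinner (x + y - (q x + q y)) h = 0" if "h \<in> K" for h
        using qc[OF that, of x] qc[OF that, of y]
        by (simp add: cinner_diff_left cinner_add_left)
    qed
    show "q (s *\<^sub>R x) = s *\<^sub>R q x" for s x
      by (simp add: scaleR_scaleC sc)
    show "norm (q x) \<le> norm x * 1" for x
    proof -
      have "norm (q x) * norm (q x) = inner x (q x)"
        using q(2)[OF q(1), of x x] by (simp add: inner_diff_left power2_norm_eq_inner flip: power2_eq_square)
      also have "\<dots> \<le> norm x * norm (q x)"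
        by (rule norm_cauchy_schwarz)
      finally show ?thesis
        by (cases "norm (q x) = 0") auto
    qed
  qed
  then have W: "app (Bop q) = q"
    using sc by (simp add: Bop_inverse)
  have qq: "q v = v" if "v \<in> K" for v
    using that by (intro q_uniq) auto
  have "Bop q \<in> N"
  proof (rule von_neumann_algebra_memI[OF N])
    fix s assume s: "s \<in> commutant N"
    have inv: "app t h \<in> K" if "t \<in> commutant N" "h \<in> K" for t h
    proof -
      have "P * t = t * P"
        using that P by (simp add: commutant_def)
      then have "app P (app t h) = app t (app P h)"
        by (metis times_bop.rep_eq)
      then show ?thesis
        using that by (simp add: K_def app_zero)
    qed
    have "q (app s u) = app s (q u)" for u
    proof (rule q_uniq)
      show "app s (q u) \<in> K"
        by (rule inv[OF s q(1)])
      show "cinner (app s u - app s (q u)) h = 0" if "h \<in> K" for h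
        using qc[OF inv[OF adj_commutant[OF N s] that], of u]
        by (simp add: cinner_adj_right app_diff)
    qed
    then show "s * Bop q = Bop q * s"
      by (intro bop_eqI) (simp add: app_simps W)
  qed
  moreover have "self_adjoint (Bop q)"
  proof (rule adj_unique)
    fix u v
    have "cinner (q u) v = cinner (q u) (q v)"
      using qc[OF q(1)[of u], of v] cinner_commute[of "q u" "v - q v"]
      by (simp add: cinner_diff_right)
    also have "\<dots> = cinner u (q v)"
      using qc[OF q(1)[of v], of u] by (simp add: cinner_diff_left)
    finally show "cinner (app (Bop q) u) v = cinner u (app (Bop q) v)"
      by (simp add: W)
  qed
  moreover have "Bop q * Bop q = Bop q" "P * Bop q = 0"
    using q(1) by (auto intro!: bop_eqI simp: app_simps W qq K_def)
  moreover have "\<forall>v. app P v = 0 \<longrightarrow> app (Bop q) v = v"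
    using qq by (simp add: W K_def)
  ultimately show ?thesis
    by blast
qed

section \<open>Positivity and norm bounds for the trace\<close>

lemma topspace_ultraweak [simp]: "topspace (ultraweak :: 'h::chilbert bop topology) = UNIV"
proof -
  let ?z = "\<lambda>_. 0 :: 'h"
  have "{T :: 'h bop. (\<Sum>n. cinner (?z n) (app T (?z n))) \<in> UNIV} \<in>
      {{T. (\<Sum>n. cinner (u n) (app T (v n))) \<in> U} | (u :: nat \<Rightarrow> 'h) (v :: nat \<Rightarrow> 'h) U.
        summable (\<lambda>n. (norm (u n))\<^sup>2) \<and> summable (\<lambda>n. (norm (v n))\<^sup>2) \<and> open U}"
    by (intro CollectI exI[of _ ?z] exI[of _ UNIV]) simp
  then show ?thesis
    unfolding ultraweak_def topology_generated_by_topspace by blast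
qed

text \<open>Cauchy--Schwarz makes the norm topology finer than the ultraweak one; this turns normality of
  the trace into boundedness.\<close>

lemma openin_ultraweak_norm_ball:
  fixes T :: "'h::chilbert bop"
  assumes "openin ultraweak U" and "T \<in> U"
  shows "\<exists>e>0. \<forall>S. (\<forall>v. norm (app (S - T) v) \<le> e * norm v) \<longrightarrow> S \<in> U"
proof -
  let ?basis = "{{T. (\<Sum>n. cinner (u n) (app T (v n))) \<in> U} | (u :: nat \<Rightarrow> 'h) (v :: nat \<Rightarrow> 'h) U.
        summable (\<lambda>n. (norm (u n))\<^sup>2) \<and> summable (\<lambda>n. (norm (v n))\<^sup>2) \<and> open U}"
  have "generate_topology_on ?basis U"
    using assms(1) by (simp add: ultraweak_def openin_topology_generated_by_iff)
  then show ?thesis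
    using assms(2)
  proof (induction arbitrary: T)
    case Empty
    then show ?case by simp
  next
    case (Int U V)
    then have TU: "T \<in> U" and TV: "T \<in> V"
      by auto
    obtain d where d: "d > 0" "\<And>S. \<forall>v. norm (app (S - T) v) \<le> d * norm v \<Longrightarrow> S \<in> U"
      using Int.IH(1)[OF TU] by blast
    obtain e where e: "e > 0" "\<And>S. \<forall>v. norm (app (S - T) v) \<le> e * norm v \<Longrightarrow> S \<in> V"
      using Int.IH(2)[OF TV] by blast
    have "S \<in> U \<inter> V" if S: "\<forall>v. norm (app (S - T) v) \<le> min d e * norm v" for S
    proof -
      have "min d e * norm v \<le> d * norm v" "min d e * norm v \<le> e * norm v" for v :: 'h
        by (simp_all add: mult_right_mono)
      then show ?thesis
        using S d(2)[of S] e(2)[of S] by (meson IntI order_trans)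
    qed
    with d(1) e(1) show ?case
      by (intro exI[of _ "min d e"]) simp
  next
    case (UN K)
    then obtain k where k: "k \<in> K" "T \<in> k"
      by blast
    from UN.IH[OF k] k(1) show ?case
      by blast
  next
    case (Basis s)
    then obtain u v :: "nat \<Rightarrow> 'h" and U where
      s: "s = {T. (\<Sum>n. cinner (u n) (app T (v n))) \<in> U}" and
      u: "summable (\<lambda>n. (norm (u n))\<^sup>2)" and v: "summable (\<lambda>n. (norm (v n))\<^sup>2)" and U: "open U"
      by blast
    have uv: "summable (\<lambda>n. norm (u n) * norm (v n))"
    proof (rule summable_comparison_test'[OF summable_add[OF u v], of 0])
      show "norm (norm (u n) * norm (v n)) \<le> (norm (u n))\<^sup>2 + (norm (v n))\<^sup>2" for n
        using sum_squares_bound[of "norm (u n)" "norm (v n)"]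
          mult_nonneg_nonneg[OF norm_ge_zero norm_ge_zero, of "u n" "v n"]
        unfolding real_norm_def abs_mult abs_norm_cancel by linarith
    qed
    define A where "A = (\<Sum>n. norm (u n) * norm (v n))"
    have A: "A \<ge> 0"
      unfolding A_def by (intro suminf_nonneg uv) simp
    have bound: "norm (cinner (u n) (app R (v n))) \<le> e * (norm (u n) * norm (v n))"
      if "\<forall>x. norm (app R x) \<le> e * norm x" for R e n
    proof -
      have "norm (cinner (u n) (app R (v n))) \<le> norm (u n) * norm (app R (v n))"
        by (rule cinner_norm_bound)
      also have "\<dots> \<le> norm (u n) * (e * norm (v n))"
        using that by (intro mult_left_mono) auto
      finally show ?thesis
        by (simp add: mult_ac)
    qed
    have summ: "summable (\<lambda>n. cinner (u n) (app R (v n)))" for R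
    proof -
      obtain K where "\<forall>x. norm (app R x) \<le> K * norm x"
        using app_bound by blast
      from bound[OF this] show ?thesis
        by (intro summable_comparison_test'[OF summable_mult[OF uv, of K], of 0]) blast
    qed
    obtain d where d: "d > 0" "\<And>z. dist z (\<Sum>n. cinner (u n) (app T (v n))) < d \<Longrightarrow> z \<in> U"
      using U Basis(2) unfolding s open_dist by blast
    define e where "e = d / (A + 1)"
    have e: "e > 0" "e * A < d"
      using d(1) A by (simp_all add: e_def field_simps)
    have "S \<in> s" if S: "\<forall>x. norm (app (S - T) x) \<le> e * norm x" for S
    proof -
      have "(\<Sum>n. cinner (u n) (app S (v n))) - (\<Sum>n. cinner (u n) (app T (v n))) =
          (\<Sum>n. cinner (u n) (app (S - T) (v n)))"
        by (simp add: app_simps cinner_diff_right suminf_diff[OF summ summ])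
      also have "norm \<dots> \<le> (\<Sum>n. e * (norm (u n) * norm (v n)))"
        by (intro norm_suminf_le bound[OF S] summable_mult uv)
      also have "\<dots> = e * A"
        using uv by (simp add: A_def suminf_mult)
      finally show ?thesis
        unfolding s using e(2) by (auto intro!: d(2) simp: dist_norm)
    qed
    with e(1) show ?case
      by blast
  qed
qed

locale gns_tracial_algebra =
  fixes M :: "'h::chilbert bop set" and \<tau> :: "'h bop \<Rightarrow> complex"
    and \<Lambda> :: "'h bop \<Rightarrow> 'l::chilbert"
  assumes tracial: "tracial_von_neumann_algebra M \<tau>"
    and gns: "gns_space M \<tau> \<Lambda>"
begin

lemma vN: "von_neumann_algebra M"
  using tracial by (simp add: tracial_von_neumann_algebra_def)

lemmas M_closed = von_neumann_algebra_closed[OF vN]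

lemma tau_add: "a \<in> M \<Longrightarrow> b \<in> M \<Longrightarrow> \<tau> (a + b) = \<tau> a + \<tau> b"
  and tau_scaleC: "a \<in> M \<Longrightarrow> \<tau> (c *\<^sub>C a) = c * \<tau> a"
  and tau_one: "\<tau> 1 = 1"
  and tau_comm: "a \<in> M \<Longrightarrow> b \<in> M \<Longrightarrow> \<tau> (a * b) = \<tau> (b * a)"
  and tau_faithful: "a \<in> M \<Longrightarrow> \<tau> (adj a * a) = 0 \<Longrightarrow> a = 0"
  and tau_normal: "continuous_map (subtopology ultraweak M) euclidean \<tau>"
  using tracial
  by (simp_all add: tracial_von_neumann_algebra_def tracial_state_def linear_on_def
      scaleC_complex_def)

lemma tau_diff: "a \<in> M \<Longrightarrow> b \<in> M \<Longrightarrow> \<tau> (a - b) = \<tau> a - \<tau> b"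
  using tau_add[of "a - b" b] by (simp add: M_closed)

lemma Lam_add: "a \<in> M \<Longrightarrow> b \<in> M \<Longrightarrow> \<Lambda> (a + b) = \<Lambda> a + \<Lambda> b"
  and Lam_scaleC: "a \<in> M \<Longrightarrow> \<Lambda> (c *\<^sub>C a) = c *\<^sub>C \<Lambda> a"
  and cinner_Lam: "a \<in> M \<Longrightarrow> b \<in> M \<Longrightarrow> cinner (\<Lambda> a) (\<Lambda> b) = \<tau> (adj a * b)"
  using gns by (simp_all add: gns_space_def linear_on_def)

lemma Lam_diff: "a \<in> M \<Longrightarrow> b \<in> M \<Longrightarrow> \<Lambda> (a - b) = \<Lambda> a - \<Lambda> b"
  using Lam_add[of "a - b" b] by (simp add: M_closed)

lemma norm_Lam_sq: "a \<in> M \<Longrightarrow> (norm (\<Lambda> a))\<^sup>2 = Re (\<tau> (adj a * a))"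
  using cinner_Lam[of a a] by (simp add: cinner_self complex_eq_iff)

lemma tau_adj: "a \<in> M \<Longrightarrow> \<tau> (adj a) = cnj (\<tau> a)"
  using cinner_Lam[of a 1] cinner_Lam[of 1 a] cinner_commute[of "\<Lambda> a" "\<Lambda> 1"]
  by (simp add: M_closed)

lemma norm_tau_le: "a \<in> M \<Longrightarrow> norm (\<tau> a) \<le> norm (\<Lambda> a)"
  using cinner_norm_bound[of "\<Lambda> 1" "\<Lambda> a"] cinner_Lam[of 1 a] norm_Lam_sq[of 1]
    power2_eq_iff_nonneg[of "norm (\<Lambda> 1)" 1]
  by (simp add: M_closed tau_one)

lemma tau_bounded: "\<exists>C. \<forall>a\<in>M. (\<forall>v. norm (app a v) \<le> norm v) \<longrightarrow> norm (\<tau> a) \<le> C"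
proof -
  have "openin (subtopology ultraweak M) {a \<in> topspace (subtopology ultraweak M). \<tau> a \<in> ball 0 1}"
    by (rule openin_continuous_map_preimage[OF tau_normal]) simp
  then obtain U where U: "openin ultraweak U" "{a \<in> M. \<tau> a \<in> ball 0 1} = U \<inter> M"
    by (auto simp: openin_subtopology)
  have "0 \<in> {a \<in> M. \<tau> a \<in> ball 0 1}"
    using tau_diff[of 0 0] by (simp add: M_closed(2))
  then have "0 \<in> U"
    by (simp only: U(2)) blast
  from openin_ultraweak_norm_ball[OF U(1) this] obtain e where
    e: "e > 0" "\<And>S. (\<forall>v. norm (app S v) \<le> e * norm v) \<Longrightarrow> S \<in> U"
    by auto
  have "norm (\<tau> a) \<le> 1 / e" if "a \<in> M" "\<forall>v. norm (app a v) \<le> norm v" for a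
  proof -
    have "complex_of_real e *\<^sub>C a \<in> U"
      using that(2) e(1) by (intro e(2)) (simp add: app_simps norm_scaleC)
    then have "complex_of_real e *\<^sub>C a \<in> {a \<in> M. \<tau> a \<in> ball 0 1}"
      using that(1) by (simp only: U(2)) (simp add: M_closed)
    then have "norm (\<tau> (complex_of_real e *\<^sub>C a)) < 1"
      by simp
    then show ?thesis
      using that(1) e(1) by (simp add: tau_scaleC norm_mult field_simps)
  qed
  then show ?thesis
    by blast
qed

text \<open>The trace is only assumed nonnegative on the elements \<open>a\<^sup>* a\<close>.  Positivity on every
  positive operator is obtained without square roots: if \<open>\<beta>\<close> is the infimum of the trace over
  \<open>0 \<le> h \<le> 1\<close>, which is finite by normality, then \<open>h - h\<^sup>2\<close> competes as well, so
  \<open>\<tau>(h) = \<tau>(h\<^sup>2) + \<tau>(h - h\<^sup>2) \<ge> \<tau>(h)\<^sup>2 + \<beta>\<close>; for \<open>\<tau>(h)\<close> close to a negative \<open>\<beta>\<close> this is absurd.\<close>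

lemma tau_nonneg_contraction:
  assumes "h \<in> M" "positive_op h" "positive_op (1 - h)"
  shows "0 \<le> Re (\<tau> h)"
proof -
  define H where "H = {h \<in> M. positive_op h \<and> positive_op (1 - h)}"
  define \<beta> where "\<beta> = Inf ((\<lambda>h. Re (\<tau> h)) ` H)"
  obtain C where C: "\<And>a. a \<in> M \<Longrightarrow> \<forall>v. norm (app a v) \<le> norm v \<Longrightarrow> norm (\<tau> a) \<le> C"
    using tau_bounded by blast
  have contr: "norm (app h v) \<le> norm v" if "h \<in> H" for h v
  proof -
    have h: "positive_op h" "positive_op (1 - h)" "self_adjoint h"
      using that by (auto simp: H_def positive_op_iff)
    have "0 \<le> inner v (app (h - h * h) v)"
      using positive_op_diff_square(1)[OF h(1,2)] by (simp add: positive_op_iff)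
    moreover have "inner v (app (h * h) v) = (norm (app h v))\<^sup>2"
      by (metis h(3) inner_adj_left times_bop.rep_eq power2_norm_eq_inner)
    moreover have "0 \<le> inner v (app (1 - h) v)"
      using h(2) by (simp add: positive_op_iff)
    moreover have "inner v v = (norm v)\<^sup>2"
      by (simp add: power2_norm_eq_inner)
    ultimately have "(norm (app h v))\<^sup>2 \<le> (norm v)\<^sup>2"
      unfolding minus_bop.rep_eq one_bop.rep_eq inner_diff_right by linarith
    then show ?thesis
      by (rule power2_le_imp_le) simp
  qed
  have bdd: "bdd_below ((\<lambda>h. Re (\<tau> h)) ` H)"
  proof (rule bdd_belowI2)
    show "- C \<le> Re (\<tau> h)" if "h \<in> H" for h
      using C[of h] contr[OF that] that abs_Re_le_cmod[of "\<tau> h"] by (auto simp: H_def)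
  qed
  have low: "\<beta> \<le> Re (\<tau> h)" if "h \<in> H" for h
    unfolding \<beta>_def using bdd that by (intro cInf_lower) auto
  have key: "(Re (\<tau> h))\<^sup>2 + \<beta> \<le> Re (\<tau> h)" if h: "h \<in> H" for h
  proof -
    have hM: "h \<in> M" "self_adjoint h"
      using h by (auto simp: H_def positive_op_iff)
    have "h - h * h \<in> H"
      using h positive_op_diff_square[of h] by (auto simp: H_def M_closed)
    then have "\<beta> \<le> Re (\<tau> (h - h * h))"
      by (rule low)
    also have "\<dots> = Re (\<tau> h) - (norm (\<Lambda> h))\<^sup>2"
      using hM by (simp add: tau_diff M_closed norm_Lam_sq)
    finally have "\<beta> + (norm (\<Lambda> h))\<^sup>2 \<le> Re (\<tau> h)"
      by simp
    moreover have "\<bar>Re (\<tau> h)\<bar> \<le> norm (\<Lambda> h)"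
      using norm_tau_le[OF hM(1)] abs_Re_le_cmod[of "\<tau> h"] by linarith
    then have "(Re (\<tau> h))\<^sup>2 \<le> (norm (\<Lambda> h))\<^sup>2"
      by (metis abs_ge_zero power2_abs power_mono)
    ultimately show ?thesis
      by simp
  qed
  \<comment> \<open>A value of the trace within \<open>\<delta>\<close> of a negative \<open>\<beta>\<close> lies below \<open>\<beta> / 2\<close>, and its square is less than \<open>\<delta>\<close>.\<close>
  have "\<beta> \<ge> 0"
  proof (rule ccontr)
    assume neg: "\<not> \<beta> \<ge> 0"
    define \<delta> where "\<delta> = min (- \<beta> / 2) (\<beta>\<^sup>2 / 4)"
    have "\<delta> > 0"
      using neg by (simp add: \<delta>_def)
    moreover have "H \<noteq> {}"
      using assms by (auto simp: H_def)
    ultimately obtain h where h: "h \<in> H" "Re (\<tau> h) < \<beta> + \<delta>"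
      using cInf_lessD[of "(\<lambda>h. Re (\<tau> h)) ` H" "\<beta> + \<delta>"] by (auto simp: \<beta>_def)
    have "Re (\<tau> h) < \<beta> / 2"
      using h(2) by (simp add: \<delta>_def)
    then have "(- \<beta> / 2)\<^sup>2 < (- Re (\<tau> h))\<^sup>2"
      using neg by (intro power_strict_mono) auto
    moreover have "(Re (\<tau> h))\<^sup>2 < \<beta>\<^sup>2 / 4"
      using key[OF h(1)] h(2) by (simp add: \<delta>_def)
    ultimately show False
      by (simp add: power_divide)
  qed
  then show ?thesis
    using low[of h] assms by (simp add: H_def)
qed

lemma tau_nonneg:
  assumes h: "h \<in> M" "positive_op h"
  shows "0 \<le> Re (\<tau> h)"
proof -
  obtain K where K: "K > 0" "\<And>v. norm (app h v) \<le> K * norm v"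
    using app_bound by blast
  define k where "k = complex_of_real (1 / K) *\<^sub>C h"
  have k: "inner v (app k v) = inner v (app h v) / K" for v
    by (simp only: k_def scaleR_scaleC[symmetric] scaleR_bop.rep_eq inner_scaleR_right) simp
  have "self_adjoint k"
    using h by (simp add: k_def adj_scaleC positive_op_iff)
  moreover have "inner v (app k v) \<le> inner v v" for v
  proof -
    have "inner v (app h v) \<le> norm v * (K * norm v)"
      using norm_cauchy_schwarz[of v "app h v"] mult_left_mono[OF K(2)[of v] norm_ge_zero[of v]]
      by linarith
    also have "\<dots> = K * inner v v"
      by (simp add: power2_norm_eq_inner[symmetric] power2_eq_square)
    finally show ?thesis
      using K(1) by (simp add: k field_simps)
  qed
  ultimately have "positive_op k" "positive_op (1 - k)"
    using h K(1) by (auto simp: positive_op_iff adj_diff app_simps inner_diff_right k)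
  then have "0 \<le> Re (\<tau> k)"
    using h by (intro tau_nonneg_contraction) (simp_all add: k_def M_closed)
  then show ?thesis
    using h(1) K(1) by (simp add: k_def tau_scaleC zero_le_divide_iff)
qed

text \<open>Positivity of the trace on \<open>a\<^sup>* (K\<^sup>2 - T\<^sup>* T) a\<close>: left multiplication is bounded on the GNS
  space by the operator norm.\<close>

lemma norm_Lam_mult_le:
  assumes "T \<in> M" "a \<in> M" "0 \<le> K" "\<And>v. norm (app T v) \<le> K * norm v"
  shows "norm (\<Lambda> (T * a)) \<le> K * norm (\<Lambda> a)"
proof -
  have "positive_op (adj a * (complex_of_real (K\<^sup>2) *\<^sub>C 1 - adj T * T) * a)"
    using assms by (intro positive_op_congruence positive_op_norm_diff) auto
  then have "0 \<le> Re (\<tau> (adj a * (complex_of_real (K\<^sup>2) *\<^sub>C 1 - adj T * T) * a))"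
    using assms by (intro tau_nonneg) (simp_all add: M_closed)
  also have "adj a * (complex_of_real (K\<^sup>2) *\<^sub>C 1 - adj T * T) * a =
      complex_of_real (K\<^sup>2) *\<^sub>C (adj a * a) - adj (T * a) * (T * a)"
    by (simp add: algebra_simps adj_mult scaleC_mult_left scaleC_mult_right)
  also have "Re (\<tau> \<dots>) = K\<^sup>2 * (norm (\<Lambda> a))\<^sup>2 - (norm (\<Lambda> (T * a)))\<^sup>2"
    using assms by (simp add: tau_diff M_closed tau_scaleC norm_Lam_sq del: of_real_power)
  finally have "(norm (\<Lambda> (T * a)))\<^sup>2 \<le> (K * norm (\<Lambda> a))\<^sup>2"
    by (simp add: power_mult_distrib)
  then show ?thesis
    using assms(3) by (simp add: power2_le_iff_abs_le)
qed

lemma norm_tau_mult_le: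
  assumes "a \<in> M" "b \<in> M"
  shows "norm (\<tau> (a * b)) \<le> norm (\<Lambda> a) * norm (\<Lambda> b)"
proof -
  have "(norm (\<Lambda> (adj a)))\<^sup>2 = (norm (\<Lambda> a))\<^sup>2"
    using assms tau_comm[of a "adj a"] by (simp add: norm_Lam_sq M_closed)
  then have "norm (\<Lambda> (adj a)) = norm (\<Lambda> a)"
    by simp
  then show ?thesis
    using cinner_norm_bound[of "\<Lambda> (adj a)" "\<Lambda> b"] assms by (simp add: cinner_Lam M_closed)
qed

end


section \<open>The conditional expectation\<close>

locale tracial_inclusion = gns_tracial_algebra M \<tau> \<Lambda>
  for M :: "'h::chilbert bop set" and \<tau> and \<Lambda> :: "'h bop \<Rightarrow> 'l::chilbert" +
  fixes B :: "'h bop set" and E :: "'h bop \<Rightarrow> 'h bop"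
  assumes vN_B: "von_neumann_algebra B" and B_subset: "B \<subseteq> M"
    and expectation: "trace_preserving_expectation M B \<tau> E"
begin

lemmas B_closed = von_neumann_algebra_closed[OF vN_B]

lemma B_in_M: "b \<in> B \<Longrightarrow> b \<in> M"
  using B_subset by blast

lemma E_in_B: "a \<in> M \<Longrightarrow> E a \<in> B"
  and E_add: "a \<in> M \<Longrightarrow> b \<in> M \<Longrightarrow> E (a + b) = E a + E b"
  and E_scaleC: "a \<in> M \<Longrightarrow> E (c *\<^sub>C a) = c *\<^sub>C E a"
  and E_bimodule: "a \<in> M \<Longrightarrow> b \<in> B \<Longrightarrow> d \<in> B \<Longrightarrow> E (b * a * d) = b * E a * d"
  and tau_E: "a \<in> M \<Longrightarrow> \<tau> (E a) = \<tau> a"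
  using expectation by (simp_all add: trace_preserving_expectation_def linear_on_def)

lemma E_in_M: "a \<in> M \<Longrightarrow> E a \<in> M"
  by (simp add: B_in_M E_in_B)

lemma E_left: "a \<in> M \<Longrightarrow> b \<in> B \<Longrightarrow> E (b * a) = b * E a"
  and E_right: "a \<in> M \<Longrightarrow> b \<in> B \<Longrightarrow> E (a * b) = E a * b"
  using E_bimodule[of a b 1] E_bimodule[of a 1 b] by (simp_all add: B_closed)

lemma norm_Lam_E_le:
  assumes a: "a \<in> M"
  shows "norm (\<Lambda> (E a)) \<le> norm (\<Lambda> a)"
proof -
  have "(norm (\<Lambda> (E a)))\<^sup>2 = Re (\<tau> (E (adj (E a) * a)))"
    using a by (simp add: norm_Lam_sq E_in_M E_left E_in_B B_closed)
  also have "\<dots> = Re (cinner (\<Lambda> (E a)) (\<Lambda> a))"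
    using a by (simp add: tau_E cinner_Lam E_in_M M_closed)
  also have "\<dots> \<le> norm (\<Lambda> (E a)) * norm (\<Lambda> a)"
    using complex_Re_le_cmod cinner_norm_bound by (rule order_trans)
  finally show ?thesis
    by (cases "norm (\<Lambda> (E a)) = 0") (auto simp: power2_eq_square)
qed

text \<open>\<open>(E a)\<^sup>*\<close> and \<open>E (a\<^sup>*)\<close> have the same trace pairing with \<open>B\<close>, and the trace is faithful.\<close>

lemma E_adj:
  assumes a: "a \<in> M"
  shows "E (adj a) = adj (E a)"
proof -
  define d where "d = E (adj a) - adj (E a)"
  have pair: "\<tau> (b * E (adj a)) = \<tau> (b * adj (E a))" if b: "b \<in> B" for b
  proof -
    have "\<tau> (b * E (adj a)) = \<tau> (b * adj a)"
      using a b tau_E[of "b * adj a"] by (simp add: E_left M_closed B_in_M)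
    also have "\<dots> = cnj (\<tau> (a * adj b))"
      using a b by (simp add: tau_adj[symmetric] adj_mult M_closed B_in_M)
    also have "\<dots> = cnj (\<tau> (E a * adj b))"
      using a b tau_E[of "a * adj b"] by (simp add: E_right M_closed B_closed B_in_M)
    also have "\<dots> = \<tau> (b * adj (E a))"
      using a b by (simp add: tau_adj[symmetric] adj_mult M_closed B_in_M E_in_M)
    finally show ?thesis .
  qed
  have d: "d \<in> B"
    using a by (simp add: d_def B_closed E_in_B M_closed)
  have "\<tau> (adj d * d) = \<tau> (adj d * E (adj a) - adj d * adj (E a))"
    by (subst (2) d_def) (simp add: right_diff_distrib)
  also have "\<dots> = \<tau> (adj d * E (adj a)) - \<tau> (adj d * adj (E a))"
    using a d by (simp add: tau_diff M_closed E_in_M B_in_M)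
  also have "\<dots> = 0"
    using d by (simp add: pair B_closed)
  finally have "d = 0"
    using d B_in_M tau_faithful by blast
  then show ?thesis
    by (simp add: d_def)
qed

text \<open>If \<open>P\<close> has derivative \<open>\<Sum>\<^sub>j a\<^sub>j \<otimes> b\<^sub>j\<close> with \<open>a\<^sub>j, b\<^sub>j \<in> B\<close>, then the functional
  \<open>u \<otimes> v \<mapsto> \<tau>(E(u) E(v))\<close> takes on \<open>l (\<partial>P) r\<close> the value below, with \<open>T = \<Sum>\<^sub>j a\<^sub>j b\<^sub>j\<close>.\<close>

definition pairing :: "'h bop \<Rightarrow> 'h bop \<Rightarrow> 'h bop \<Rightarrow> complex" where
  "pairing T l r = \<tau> (E l * T * E r)"

lemma pairing_bounded:
  assumes "T \<in> M"
  shows "\<exists>C>0. \<forall>l\<in>M. \<forall>r\<in>M. norm (pairing T l r) \<le> C * norm (\<Lambda> l) * norm (\<Lambda> r)"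
proof -
  obtain K where K: "K > 0" "\<And>v. norm (app T v) \<le> K * norm v"
    using app_bound by blast
  have "norm (pairing T l r) \<le> K * norm (\<Lambda> l) * norm (\<Lambda> r)" if "l \<in> M" "r \<in> M" for l r
  proof -
    have "norm (pairing T l r) \<le> norm (\<Lambda> (E l)) * norm (\<Lambda> (T * E r))"
      unfolding pairing_def mult.assoc using that assms
      by (intro norm_tau_mult_le) (simp_all add: M_closed E_in_M)
    also have "\<dots> \<le> norm (\<Lambda> l) * (K * norm (\<Lambda> (E r)))"
      using that assms K by (intro mult_mono norm_Lam_E_le norm_Lam_mult_le) (auto simp: E_in_M)
    also have "\<dots> \<le> norm (\<Lambda> l) * (K * norm (\<Lambda> r))"
      using that K(1) by (intro mult_left_mono norm_Lam_E_le) auto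
    finally show ?thesis
      by (simp add: mult_ac)
  qed
  with K(1) show ?thesis
    by blast
qed

lemma pairing_add:
  assumes "T \<in> M" "l \<in> M" "r \<in> M" "m \<in> M"
  shows "pairing T (l + m) r = pairing T l r + pairing T m r"
    and "pairing T l (r + m) = pairing T l r + pairing T l m"
  using assms by (simp_all add: pairing_def E_add distrib_left distrib_right tau_add M_closed E_in_M)

lemma pairing_diff:
  assumes "T \<in> M" "l \<in> M" "r \<in> M" "m \<in> M"
  shows "pairing T (l - m) r = pairing T l r - pairing T m r"
    and "pairing T l (r - m) = pairing T l r - pairing T l m"
proof -
  show "pairing T (l - m) r = pairing T l r - pairing T m r"
    using pairing_add(1)[of T "l - m" r m] assms by (simp add: M_closed)
  show "pairing T l (r - m) = pairing T l r - pairing T l m"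
    using pairing_add(2)[of T l "r - m" m] assms by (simp add: M_closed)
qed

lemma pairing_scaleC:
  assumes "T \<in> M" "l \<in> M" "r \<in> M"
  shows "pairing T (c *\<^sub>C l) r = c * pairing T l r"
    and "pairing T l (c *\<^sub>C r) = c * pairing T l r"
    and "pairing (c *\<^sub>C T) l r = c * pairing T l r"
  using assms
  by (simp_all add: pairing_def E_scaleC scaleC_mult_left scaleC_mult_right tau_scaleC M_closed E_in_M)

lemma pairing_sum:
  assumes "T \<in> M" "\<And>t. t \<in> J \<Longrightarrow> f t \<in> M" "r \<in> M"
  shows "pairing T (\<Sum>t\<in>J. f t) r = (\<Sum>t\<in>J. pairing T (f t) r)"
    and "pairing T r (\<Sum>t\<in>J. f t) = (\<Sum>t\<in>J. pairing T r (f t))"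
proof -
  have "pairing T 0 r = 0" "pairing T r 0 = 0"
    using pairing_diff[of T r r r] assms by simp_all
  then show "pairing T (\<Sum>t\<in>J. f t) r = (\<Sum>t\<in>J. pairing T (f t) r)"
    and "pairing T r (\<Sum>t\<in>J. f t) = (\<Sum>t\<in>J. pairing T r (f t))"
    using assms(2)
    by (induction J rule: infinite_finite_induct)
      (simp_all add: pairing_add assms(1,3) von_neumann_algebra_sum_closed[OF vN])
qed

text \<open>Since \<open>E a\<close> is self-adjoint, \<open>E(a) (T - c) E(a)\<close> is a positive operator, and Cauchy--Schwarz
  bounds \<open>\<tau>(a) = \<tau>(E a)\<close> by the \<open>L\<^sup>2\<close> norm of \<open>E a\<close>.\<close>

lemma pairing_self_adjoint_ge:
  assumes "T \<in> M" and T: "c *\<^sub>R 1 \<sqsubseteq> T" and "0 \<le> c" and a: "a \<in> M" "self_adjoint a"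
  shows "c * (Re (\<tau> a))\<^sup>2 \<le> Re (pairing T a a)"
proof -
  have Ea: "E a \<in> M" "self_adjoint (E a)"
    using a by (simp_all add: E_in_M E_adj[symmetric])
  have "positive_op (adj (E a) * (T - complex_of_real c *\<^sub>C 1) * E a)"
    using T by (intro positive_op_congruence) (simp add: op_le_def scaleR_scaleC)
  then have "0 \<le> Re (\<tau> (adj (E a) * (T - complex_of_real c *\<^sub>C 1) * E a))"
    using Ea assms(1) by (intro tau_nonneg) (simp_all add: M_closed)
  also have "adj (E a) * (T - complex_of_real c *\<^sub>C 1) * E a =
      E a * T * E a - complex_of_real c *\<^sub>C (adj (E a) * E a)"
    using Ea by (simp add: algebra_simps scaleC_mult_left scaleC_mult_right)
  also have "Re (\<tau> \<dots>) = Re (pairing T a a) - c * (norm (\<Lambda> (E a)))\<^sup>2"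
    using Ea(1) assms(1)
    by (simp add: tau_diff tau_scaleC M_closed norm_Lam_sq pairing_def)
  finally have "c * (norm (\<Lambda> (E a)))\<^sup>2 \<le> Re (pairing T a a)"
    by simp
  moreover have "\<bar>Re (\<tau> a)\<bar> \<le> norm (\<Lambda> (E a))"
    using norm_tau_le[OF Ea(1)] abs_Re_le_cmod[of "\<tau> a"] tau_E[OF a(1)] by simp
  then have "(Re (\<tau> a))\<^sup>2 \<le> (norm (\<Lambda> (E a)))\<^sup>2"
    by (metis abs_ge_zero power2_abs power_mono)
  ultimately show ?thesis
    using mult_left_mono[OF _ assms(3)] by fastforce
qed

end

section \<open>Moments against a conjugate variable\<close>

lemma word_refl: "word x j b k k = b k"
  by (simp add: word_def)

lemma word_Suc: "k \<le> l \<Longrightarrow> word x j b k (Suc l) = word x j b k l * x (j (Suc l)) * b (Suc l)"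
  by (simp add: word_def mult.assoc)

lemma word_cong:
  assumes "k \<le> l" "\<And>r. k \<le> r \<Longrightarrow> r \<le> l \<Longrightarrow> b r = b' r" "\<And>r. k < r \<Longrightarrow> r \<le> l \<Longrightarrow> j r = j' r"
  shows "word x j b k l = word x j' b' k l"
proof -
  have "map (\<lambda>r. x (j r) * b r) [Suc k..<Suc l] = map (\<lambda>r. x (j' r) * b' r) [Suc k..<Suc l]"
    using assms by (intro map_cong) auto
  then show ?thesis
    using assms(1) assms(2)[of k] by (simp only: word_def)
qed

lemma word_mult_right:
  assumes "k \<le> d"
  shows "word x j (b(d := b d * c)) k d = word x j b k d * c"
proof (cases d)
  case 0
  then show ?thesis
    using assms by (simp add: word_refl)
next
  case (Suc l)
  show ?thesis
  proof (cases "k = d")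
    case False
    then have kl: "k \<le> l"
      using assms Suc by simp
    have "word x j (b(d := b d * c)) k l = word x j b k l"
      using kl Suc by (intro word_cong) auto
    then show ?thesis
      using kl by (simp add: Suc word_Suc mult.assoc)
  qed (simp add: word_refl)
qed

lemma additive_on_sum:
  fixes f :: "'a::comm_monoid_add \<Rightarrow> 'b::ab_group_add"
  assumes "\<And>p q. p \<in> A \<Longrightarrow> q \<in> A \<Longrightarrow> f (p + q) = f p + f q"
    and "0 \<in> A" "\<And>p q. p \<in> A \<Longrightarrow> q \<in> A \<Longrightarrow> p + q \<in> A" "\<And>t. t \<in> J \<Longrightarrow> g t \<in> A"
  shows "f (\<Sum>t\<in>J. g t) = (\<Sum>t\<in>J. f (g t))"
proof -
  have f0: "f 0 = 0"
    using assms(1)[of 0 0] assms(2) by simp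
  have "(\<Sum>t\<in>J. g t) \<in> A \<and> f (\<Sum>t\<in>J. g t) = (\<Sum>t\<in>J. f (g t))"
    using assms(4)
    by (induction J rule: infinite_finite_induct) (simp_all add: f0 assms(1-3))
  then show ?thesis
    by blast
qed

context tracial_inclusion
begin

lemma word_in_M:
  assumes "\<And>i. x i \<in> M" "\<And>r. r \<le> l \<Longrightarrow> b r \<in> B" "k \<le> l"
  shows "word x j b k l \<in> M"
  using assms(3,2)
proof (induction l rule: dec_induct)
  case base
  then show ?case
    by (simp add: word_refl B_in_M)
next
  case (step l)
  then show ?case
    by (simp add: word_Suc M_closed assms(1) B_in_M)
qed

text \<open>By the Leibniz rule the defining formula of a conjugate variable, which is stated for words,
  extends to a power of a linear element \<open>S\<close> factor by factor.  The induction carries an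
  arbitrary word in front of the power: expanding one factor \<open>S\<close> absorbs it into that word, either
  with a new letter \<open>x\<close>, whose derivative is the new term, or through \<open>b\<^sub>0\<close> into the last
  coefficient.\<close>

lemma word_power_expansion:
  fixes f :: "'h bop \<Rightarrow> complex" and \<Theta> :: "'i \<Rightarrow> 'h bop \<Rightarrow> 'h bop \<Rightarrow> complex"
  assumes f_add: "\<And>p q. p \<in> M \<Longrightarrow> q \<in> M \<Longrightarrow> f (p + q) = f p + f q"
    and left_add: "\<And>j p q r. p \<in> M \<Longrightarrow> q \<in> M \<Longrightarrow> r \<in> M \<Longrightarrow> \<Theta> j (p + q) r = \<Theta> j p r + \<Theta> j q r"
    and right_add: "\<And>j p q r. p \<in> M \<Longrightarrow> q \<in> M \<Longrightarrow> r \<in> M \<Longrightarrow> \<Theta> j r (p + q) = \<Theta> j r p + \<Theta> j r q"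
    and words: "\<And>d j w. \<forall>k\<le>d. w k \<in> B \<Longrightarrow>
      f (word x j w 0 d) = (\<Sum>k=1..d. \<Theta> (j k) (word x j w 0 (k - 1)) (word x j w k d))"
    and x: "\<And>i. x i \<in> M"
    and ab: "\<And>t. t \<in> J \<Longrightarrow> a t \<in> B" "\<And>t. t \<in> J \<Longrightarrow> b t \<in> B" "b0 \<in> B"
    and S: "S = (\<Sum>t\<in>J. a t * x (\<iota> t) * b t) + b0"
    and w: "\<forall>k\<le>d. w k \<in> B"
  shows "f (word x j w 0 d * S ^ N) =
      (\<Sum>k=1..d. \<Theta> (j k) (word x j w 0 (k - 1)) (word x j w k d * S ^ N)) +
      (\<Sum>k<N. \<Sum>t\<in>J. \<Theta> (\<iota> t) (word x j w 0 d * S ^ k * a t) (b t * S ^ (N - 1 - k)))"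
  using w
proof (induction N arbitrary: d j w)
  case 0
  then show ?case
    by (simp add: words)
next
  case (Suc N)
  note w = Suc.prems
  define u where "u = word x j w 0 d"
  define m where "m t = a t * x (\<iota> t) * b t" for t
  have mM: "m t \<in> M" if "t \<in> J" for t
    using that x ab by (simp add: m_def M_closed B_in_M)
  have b0M: "b0 \<in> M"
    using ab(3) by (rule B_in_M)
  have Sm: "S = (\<Sum>t\<in>J. m t) + b0"
    by (simp add: S m_def)
  have sum_mM: "(\<Sum>t\<in>J. m t) \<in> M"
    using mM by (intro von_neumann_algebra_sum_closed[OF vN])
  have SM: "S \<in> M" "\<And>k. S ^ k \<in> M"
    by (simp_all add: Sm M_closed sum_mM b0M)
  have wM: "word x j w k l \<in> M" if "k \<le> l" "l \<le> d" for k l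
    using w that by (intro word_in_M x) auto
  have uM: "u \<in> M"
    using wM[of 0 d] by (simp add: u_def)
  define G where "G q =
      (\<Sum>k=1..d. \<Theta> (j k) (word x j w 0 (k - 1)) (word x j w k d * q * S ^ N)) +
      (\<Sum>k<N. \<Sum>t\<in>J. \<Theta> (\<iota> t) (u * q * S ^ k * a t) (b t * S ^ (N - 1 - k)))" for q
  have G_add: "G (p + q) = G p + G q" if "p \<in> M" "q \<in> M" for p q
  proof -
    have "(\<Sum>k=1..d. \<Theta> (j k) (word x j w 0 (k - 1)) (word x j w k d * (p + q) * S ^ N)) =
        (\<Sum>k=1..d. \<Theta> (j k) (word x j w 0 (k - 1)) (word x j w k d * p * S ^ N) +
          \<Theta> (j k) (word x j w 0 (k - 1)) (word x j w k d * q * S ^ N))"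
    proof (intro sum.cong refl)
      fix k assume "k \<in> {1..d}"
      then have "word x j w 0 (k - 1) \<in> M" "word x j w k d \<in> M"
        by (auto intro: wM)
      then show "\<Theta> (j k) (word x j w 0 (k - 1)) (word x j w k d * (p + q) * S ^ N) =
          \<Theta> (j k) (word x j w 0 (k - 1)) (word x j w k d * p * S ^ N) +
          \<Theta> (j k) (word x j w 0 (k - 1)) (word x j w k d * q * S ^ N)"
        using that by (simp only: distrib_left distrib_right) (simp add: right_add M_closed SM)
    qed
    moreover have "(\<Sum>k<N. \<Sum>t\<in>J. \<Theta> (\<iota> t) (u * (p + q) * S ^ k * a t) (b t * S ^ (N - 1 - k))) =
        (\<Sum>k<N. \<Sum>t\<in>J. \<Theta> (\<iota> t) (u * p * S ^ k * a t) (b t * S ^ (N - 1 - k)) +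
          \<Theta> (\<iota> t) (u * q * S ^ k * a t) (b t * S ^ (N - 1 - k)))"
      using that ab
      by (intro sum.cong refl)
        (simp add: distrib_left distrib_right left_add M_closed uM SM B_in_M)
    ultimately show ?thesis
      by (simp add: G_def sum.distrib)
  qed
  have letter: "f (u * m t * S ^ N) = G (m t) + \<Theta> (\<iota> t) (u * a t) (b t * S ^ N)" if t: "t \<in> J" for t
  proof -
    define w' where "w' = w(d := w d * a t, Suc d := b t)"
    define j' where "j' = j(Suc d := \<iota> t)"
    have w': "\<forall>k\<le>Suc d. w' k \<in> B"
      using w ab t by (auto simp: w'_def B_closed)
    have same: "word x j' w' 0 (k - 1) = word x j w 0 (k - 1)" if "1 \<le> k" "k \<le> d" for k
      using that by (intro word_cong) (auto simp: w'_def j'_def)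
    have short: "word x j' w' k d = word x j w k d * a t" if "k \<le> d" for k
    proof -
      have "word x j' w' k d = word x j (w(d := w d * a t)) k d"
        using that by (intro word_cong) (auto simp: w'_def j'_def)
      then show ?thesis
        by (simp add: word_mult_right that)
    qed
    have long: "word x j' w' k (Suc d) = word x j w k d * m t" if "k \<le> d" for k
      using that short[OF that] by (simp add: word_Suc m_def mult.assoc) (simp add: w'_def j'_def)
    have last: "word x j' w' (Suc d) (Suc d) = b t" "j' (Suc d) = \<iota> t"
      by (simp_all add: word_refl w'_def j'_def)
    have j': "j' k = j k" if "k \<le> d" for k
      using that by (simp add: j'_def)
    have split: "(\<Sum>k=1..Suc d. h k) = (\<Sum>k=1..d. h k) + h (Suc d)" for h :: "nat \<Rightarrow> complex"
      by simp
    have "f (u * m t * S ^ N) = f (word x j' w' 0 (Suc d) * S ^ N)"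
      by (simp add: long u_def)
    also have "\<dots> = (\<Sum>k=1..d. \<Theta> (j' k) (word x j' w' 0 (k - 1)) (word x j' w' k (Suc d) * S ^ N)) +
        \<Theta> (\<iota> t) (u * a t) (b t * S ^ N) +
        (\<Sum>k<N. \<Sum>s\<in>J. \<Theta> (\<iota> s) (u * m t * S ^ k * a s) (b s * S ^ (N - 1 - k)))"
      unfolding Suc.IH[OF w'] split by (simp add: last short long u_def)
    also have "(\<Sum>k=1..d. \<Theta> (j' k) (word x j' w' 0 (k - 1)) (word x j' w' k (Suc d) * S ^ N)) =
        (\<Sum>k=1..d. \<Theta> (j k) (word x j w 0 (k - 1)) (word x j w k d * m t * S ^ N))"
      by (intro sum.cong refl) (simp add: same long j' del: One_nat_def)
    finally show ?thesis
      by (simp add: G_def)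
  qed
  have coeff: "f (u * b0 * S ^ N) = G b0"
  proof -
    define w' where "w' = w(d := w d * b0)"
    have w': "\<forall>k\<le>d. w' k \<in> B"
      using w ab(3) by (auto simp: w'_def B_closed)
    have same: "word x j w' 0 (k - 1) = word x j w 0 (k - 1)" if "1 \<le> k" "k \<le> d" for k
      using that by (intro word_cong) (auto simp: w'_def)
    have long: "word x j w' k d = word x j w k d * b0" if "k \<le> d" for k
      using that by (simp add: w'_def word_mult_right)
    have "f (u * b0 * S ^ N) = f (word x j w' 0 d * S ^ N)"
      by (simp add: long u_def)
    also have "\<dots> = G b0"
      unfolding Suc.IH[OF w'] G_def
      by (intro arg_cong2[where f = "(+)"] sum.cong refl)
        (simp_all add: same long u_def del: One_nat_def)
    finally show ?thesis .
  qed
  have "f (u * S ^ Suc N) = f (u * (\<Sum>t\<in>J. m t) * S ^ N + u * b0 * S ^ N)"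
    by (simp add: distrib_left distrib_right mult.assoc flip: Sm)
      (simp add: Sm distrib_left distrib_right mult.assoc)
  also have "\<dots> = f (\<Sum>t\<in>J. u * m t * S ^ N) + f (u * b0 * S ^ N)"
    by (simp add: f_add M_closed uM sum_mM SM b0M sum_distrib_left sum_distrib_right
        von_neumann_algebra_sum_closed[OF vN] mM)
  also have "\<dots> = (\<Sum>t\<in>J. f (u * m t * S ^ N)) + f (u * b0 * S ^ N)"
    by (subst additive_on_sum[where A = M and f = f]) (simp_all add: f_add M_closed uM mM SM)
  also have "\<dots> = (\<Sum>t\<in>J. G (m t)) + G b0 + (\<Sum>t\<in>J. \<Theta> (\<iota> t) (u * a t) (b t * S ^ N))"
    by (simp add: letter coeff sum.distrib)
  also have "(\<Sum>t\<in>J. G (m t)) + G b0 = G S"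
    unfolding Sm by (simp add: G_add sum_mM b0M)
      (rule additive_on_sum[symmetric, where A = M], simp_all add: G_add M_closed mM)
  also have "G S + (\<Sum>t\<in>J. \<Theta> (\<iota> t) (u * a t) (b t * S ^ N)) =
      (\<Sum>k=1..d. \<Theta> (j k) (word x j w 0 (k - 1)) (word x j w k d * S ^ Suc N)) +
      (\<Sum>k<Suc N. \<Sum>t\<in>J. \<Theta> (\<iota> t) (u * S ^ k * a t) (b t * S ^ (Suc N - 1 - k)))"
    unfolding G_def sum.lessThan_Suc_shift by (simp add: mult.assoc)
  finally show ?case
    by (simp add: u_def)
qed

text \<open>The coefficients lie in \<open>B\<close> and can be moved through the expectation, so what remains of the
  derivative of \<open>S\<close> in the direction \<open>i\<close> is the single element \<open>T = \<Sum> a\<^sub>t b\<^sub>t\<close> over the letters equal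
  to \<open>x\<^sub>i\<close>.\<close>

lemma conjugate_variable_power:
  assumes conj: "conjugate_variable B \<tau> E \<Lambda> \<eta> x i \<xi>"
    and \<eta>: "\<And>j. linear_on B (\<eta> i j)" "\<And>j. \<forall>q\<in>B. \<eta> i j q \<in> B"
    and x: "\<And>i. x i \<in> M"
    and J: "finite J"
    and ab: "\<And>t. t \<in> J \<Longrightarrow> a t \<in> B" "\<And>t. t \<in> J \<Longrightarrow> b t \<in> B" "b0 \<in> B"
    and diag: "\<And>t q. t \<in> J \<Longrightarrow> q \<in> M \<Longrightarrow>
      extend_cov E \<eta> i (\<iota> t) q = (if \<iota> t = i then E q else 0)"
    and S: "S = (\<Sum>t\<in>J. a t * x (\<iota> t) * b t) + b0"
  shows "cinner \<xi> (\<Lambda> (S ^ N)) =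
    (\<Sum>k<N. pairing (\<Sum>t\<in>{t\<in>J. \<iota> t = i}. a t * b t) (S ^ k) (S ^ (N - 1 - k)))"
proof -
  define \<Theta> where "\<Theta> j l r = \<tau> (extend_cov E \<eta> i j l * E r)" for j l r
  have covM: "extend_cov E \<eta> i j q \<in> M" if "q \<in> M" for j q
    using that \<eta>(2) by (simp add: extend_cov_def E_in_B B_in_M)
  have cov_add: "extend_cov E \<eta> i j (p + q) = extend_cov E \<eta> i j p + extend_cov E \<eta> i j q"
    if "p \<in> M" "q \<in> M" for j p q
    using that \<eta>(1)[of j] by (simp add: extend_cov_def E_add E_in_B linear_on_def)
  have SM: "S ^ k \<in> M" for k
    using ab x unfolding S
    by (intro M_closed von_neumann_algebra_sum_closed[OF vN]) (simp_all add: B_in_M)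
  have one: "word x (\<lambda>_. i) (\<lambda>_. 1) 0 0 = 1"
    by (simp add: word_refl)
  have "cinner \<xi> (\<Lambda> (word x (\<lambda>_. i) (\<lambda>_. 1) 0 0 * S ^ N)) =
      (\<Sum>k=1..0. \<Theta> i (word x (\<lambda>_. i) (\<lambda>_. 1) 0 (k - 1)) (word x (\<lambda>_. i) (\<lambda>_. 1) k 0 * S ^ N)) +
      (\<Sum>k<N. \<Sum>t\<in>J. \<Theta> (\<iota> t) (word x (\<lambda>_. i) (\<lambda>_. 1) 0 0 * S ^ k * a t) (b t * S ^ (N - 1 - k)))"
  proof (rule word_power_expansion[where f = "\<lambda>p. cinner \<xi> (\<Lambda> p)" and x = x, OF _ _ _ _ x ab S])
    show "\<And>p q. p \<in> M \<Longrightarrow> q \<in> M \<Longrightarrow> cinner \<xi> (\<Lambda> (p + q)) = cinner \<xi> (\<Lambda> p) + cinner \<xi> (\<Lambda> q)"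
      by (simp add: Lam_add cinner_add_right)
    show "\<And>j p q r. p \<in> M \<Longrightarrow> q \<in> M \<Longrightarrow> r \<in> M \<Longrightarrow> \<Theta> j (p + q) r = \<Theta> j p r + \<Theta> j q r"
      by (simp add: \<Theta>_def cov_add distrib_right tau_add M_closed covM E_in_M)
    show "\<And>j p q r. p \<in> M \<Longrightarrow> q \<in> M \<Longrightarrow> r \<in> M \<Longrightarrow> \<Theta> j r (p + q) = \<Theta> j r p + \<Theta> j r q"
      by (simp add: \<Theta>_def E_add distrib_left tau_add M_closed covM E_in_M)
    show "\<And>d j w. \<forall>k\<le>d. w k \<in> B \<Longrightarrow> cinner \<xi> (\<Lambda> (word x j w 0 d)) =
        (\<Sum>k=1..d. \<Theta> (j k) (word x j w 0 (k - 1)) (word x j w k d))"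
      using conj by (simp add: conjugate_variable_def \<Theta>_def)
  qed (simp_all add: B_closed)
  then have "cinner \<xi> (\<Lambda> (S ^ N)) =
      (\<Sum>k<N. \<Sum>t\<in>J. \<Theta> (\<iota> t) (S ^ k * a t) (b t * S ^ (N - 1 - k)))"
    by (simp add: one)
  also have "\<dots> = (\<Sum>k<N. pairing (\<Sum>t\<in>{t\<in>J. \<iota> t = i}. a t * b t) (S ^ k) (S ^ (N - 1 - k)))"
  proof (rule sum.cong[OF refl])
    fix k
    have "(\<Sum>t\<in>J. \<Theta> (\<iota> t) (S ^ k * a t) (b t * S ^ (N - 1 - k))) =
        (\<Sum>t\<in>J. if \<iota> t = i then \<tau> (E (S ^ k) * (a t * b t) * E (S ^ (N - 1 - k))) else 0)"
    proof (rule sum.cong[OF refl])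
      fix t assume t: "t \<in> J"
      have "\<tau> 0 = 0"
        using tau_diff[of 0 0] by (simp add: M_closed)
      then show "\<Theta> (\<iota> t) (S ^ k * a t) (b t * S ^ (N - 1 - k)) =
          (if \<iota> t = i then \<tau> (E (S ^ k) * (a t * b t) * E (S ^ (N - 1 - k))) else 0)"
        using t ab
        by (simp add: \<Theta>_def diag M_closed SM B_in_M E_left E_right mult.assoc)
    qed
    also have "\<dots> = (\<Sum>t\<in>{t\<in>J. \<iota> t = i}. \<tau> (E (S ^ k) * (a t * b t) * E (S ^ (N - 1 - k))))"
      using J by (simp add: sum.If_cases Int_def)
    also have "\<dots> = \<tau> (\<Sum>t\<in>{t\<in>J. \<iota> t = i}. E (S ^ k) * (a t * b t) * E (S ^ (N - 1 - k)))"
      using ab by (intro additive_on_sum[symmetric, where A = M])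
        (auto simp: tau_add M_closed SM E_in_M B_in_M)
    also have "\<dots> = pairing (\<Sum>t\<in>{t\<in>J. \<iota> t = i}. a t * b t) (S ^ k) (S ^ (N - 1 - k))"
      by (simp add: pairing_def sum_distrib_left sum_distrib_right)
    finally show "(\<Sum>t\<in>J. \<Theta> (\<iota> t) (S ^ k * a t) (b t * S ^ (N - 1 - k))) =
        pairing (\<Sum>t\<in>{t\<in>J. \<iota> t = i}. a t * b t) (S ^ k) (S ^ (N - 1 - k))" .
  qed
  finally show ?thesis .
qed


section \<open>The resolvent identity\<close>

text \<open>Up to the derivative of \<open>S\<close>, the derivative of \<open>\<Sum> S\<^sup>n\<close> is the Cauchy product of the series
  with itself, so it factors as \<open>R \<otimes> R\<close>.  The partial sums are kept in closed form with
  the help of \<open>S\<^sup>m R - S\<^sup>m\<^sup>+\<^sup>1 R = S\<^sup>m\<close>, and the remainders decay like \<open>N \<rho>\<^sup>N\<close>.\<close>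

lemma conjugate_geometric_series:
  assumes T: "T \<in> M" and S: "S \<in> M"
    and \<rho>: "0 \<le> \<rho>" "\<rho> < 1" "\<And>v. norm (app S v) \<le> \<rho> * norm v"
    and mom: "\<And>N. cinner \<xi> (\<Lambda> (S ^ N)) = z * (\<Sum>k<N. pairing T (S ^ k) (S ^ (N - 1 - k)))"
    and R: "R \<in> M" "(1 - S) * R = 1"
  shows "cinner \<xi> (\<Lambda> R) = z * pairing T R R"
proof -
  obtain C where C: "C > 0" "\<And>l r. l \<in> M \<Longrightarrow> r \<in> M \<Longrightarrow> norm (pairing T l r) \<le> C * norm (\<Lambda> l) * norm (\<Lambda> r)"
    using pairing_bounded[OF T] by blast
  define Q where "Q N = (\<Sum>k<N. S ^ k)" for N
  have SkM: "S ^ k \<in> M" "S ^ k * R \<in> M" for k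
    using S R by (simp_all add: M_closed)
  have QM: "Q N \<in> M" for N
    unfolding Q_def using SkM by (intro von_neumann_algebra_sum_closed[OF vN])
  have SR: "S * R = R - 1"
    using R(2) by (simp add: algebra_simps)
  have step: "S ^ Suc k * R = S ^ k * R - S ^ k" for k
    by (simp only: power_Suc2 mult.assoc SR right_diff_distrib mult_1_right)
  have Q: "Q N = R - S ^ N * R" for N
    by (induction N) (simp_all only: step, simp_all add: Q_def)
  have decay: "norm (\<Lambda> (S ^ k * a)) \<le> \<rho> ^ k * norm (\<Lambda> a)" if "a \<in> M" for k a
  proof (induction k)
    case (Suc k)
    have "norm (\<Lambda> (S * (S ^ k * a))) \<le> \<rho> * norm (\<Lambda> (S ^ k * a))"
      using that SkM \<rho> S by (intro norm_Lam_mult_le) (simp_all add: M_closed)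
    also have "\<dots> \<le> \<rho> * (\<rho> ^ k * norm (\<Lambda> a))"
      using Suc \<rho>(1) by (rule mult_left_mono)
    finally show ?case
      by (simp add: mult.assoc)
  qed simp
  have partial: "(\<Sum>n<N. \<Sum>k<n. pairing T (S ^ k) (S ^ (n - 1 - k))) =
      pairing T (Q N) R - (\<Sum>k<N. pairing T (S ^ k) (S ^ (N - 1 - k) * R))" for N
  proof (induction N)
    case 0
    show ?case
      using pairing_sum(1)[of T "{}" "\<lambda>_. 0" R] T R by (simp add: Q_def)
  next
    case (Suc N)
    have "(\<Sum>k<N. pairing T (S ^ k) (S ^ (N - k) * R)) =
        (\<Sum>k<N. pairing T (S ^ k) (S ^ (N - 1 - k) * R) - pairing T (S ^ k) (S ^ (N - 1 - k)))"
    proof (rule sum.cong[OF refl])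
      fix k assume "k \<in> {..<N}"
      then have "N - k = Suc (N - 1 - k)"
        by auto
      then show "pairing T (S ^ k) (S ^ (N - k) * R) =
          pairing T (S ^ k) (S ^ (N - 1 - k) * R) - pairing T (S ^ k) (S ^ (N - 1 - k))"
        using T SkM by (simp only: step pairing_diff)
    qed
    moreover have "pairing T (Q (Suc N)) R = pairing T (Q N) R + pairing T (S ^ N) R"
      using pairing_add(1)[OF T QM[of N] R(1) SkM(1)[of N]] by (simp add: Q_def)
    ultimately show ?case
      using Suc.IH by (simp add: sum_subtractf)
  qed
  define D where "D = cinner \<xi> (\<Lambda> R) - z * pairing T R R"
  define L where "L = norm (\<Lambda> R)"
  define A where "A = norm \<xi> * L + norm z * C * L * L"
  define A' where "A' = norm z * C * norm (\<Lambda> 1) * L"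
  have bound: "norm D \<le> A * \<rho> ^ Suc N + A' * (real (Suc N) * \<rho> ^ N)" for N
  proof -
    have "cinner \<xi> (\<Lambda> (Q (Suc N))) = (\<Sum>n<Suc N. cinner \<xi> (\<Lambda> (S ^ n)))"
      unfolding Q_def
      by (rule additive_on_sum[where A = M and f = "\<lambda>p. cinner \<xi> (\<Lambda> p)"])
        (simp_all add: Lam_add cinner_add_right M_closed SkM)
    also have "\<dots> = z * (\<Sum>n<Suc N. \<Sum>k<n. pairing T (S ^ k) (S ^ (n - 1 - k)))"
      by (simp only: mom sum_distrib_left)
    finally have Qsum: "cinner \<xi> (\<Lambda> (Q (Suc N))) =
        z * (pairing T (Q (Suc N)) R - (\<Sum>k<Suc N. pairing T (S ^ k) (S ^ (Suc N - 1 - k) * R)))"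
      by (simp only: partial)
    have "cinner \<xi> (\<Lambda> (Q (Suc N))) = cinner \<xi> (\<Lambda> R) - cinner \<xi> (\<Lambda> (S ^ Suc N * R))"
      "pairing T (Q (Suc N)) R = pairing T R R - pairing T (S ^ Suc N * R) R"
      unfolding Q using T R(1) SkM(2)[of "Suc N"]
      by (simp_all only: Lam_diff cinner_diff_right pairing_diff)
    with Qsum have D: "D = cinner \<xi> (\<Lambda> (S ^ Suc N * R)) - z * pairing T (S ^ Suc N * R) R
        - z * (\<Sum>k<Suc N. pairing T (S ^ k) (S ^ (N - k) * R))"
      by (simp add: D_def algebra_simps)
    have "norm (cinner \<xi> (\<Lambda> (S ^ Suc N * R))) \<le> norm \<xi> * (\<rho> ^ Suc N * L)"
      unfolding L_def
      using cinner_norm_bound mult_left_mono[OF decay[OF R(1)] norm_ge_zero] by (rule order_trans)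
    moreover have "norm (z * pairing T (S ^ Suc N * R) R) \<le> norm z * (C * (\<rho> ^ Suc N * L) * L)"
    proof -
      have "norm (pairing T (S ^ Suc N * R) R) \<le> C * norm (\<Lambda> (S ^ Suc N * R)) * L"
        unfolding L_def by (rule C(2)[OF SkM(2) R(1)])
      also have "\<dots> \<le> C * (\<rho> ^ Suc N * L) * L"
        using decay[OF R(1), of "Suc N"] C(1) by (intro mult_right_mono mult_left_mono) (auto simp: L_def)
      finally show ?thesis
        by (simp add: norm_mult mult_left_mono)
    qed
    moreover have "norm (z * (\<Sum>k<Suc N. pairing T (S ^ k) (S ^ (N - k) * R)))
        \<le> norm z * (real (Suc N) * (C * norm (\<Lambda> 1) * L * \<rho> ^ N))"
    proof -
      have "norm (pairing T (S ^ k) (S ^ (N - k) * R)) \<le> C * norm (\<Lambda> 1) * L * \<rho> ^ N"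
        if "k \<in> {..<Suc N}" for k
      proof -
        have "norm (\<Lambda> (S ^ k)) \<le> \<rho> ^ k * norm (\<Lambda> 1)"
          using decay[of 1 k] by (simp add: M_closed)
        then have "norm (\<Lambda> (S ^ k)) * norm (\<Lambda> (S ^ (N - k) * R)) \<le>
            (\<rho> ^ k * norm (\<Lambda> 1)) * (\<rho> ^ (N - k) * L)"
          using decay[OF R(1), of "N - k"] \<rho>(1) by (intro mult_mono) (auto simp: L_def)
        also have "\<dots> = norm (\<Lambda> 1) * L * \<rho> ^ (k + (N - k))"
          by (simp add: power_add mult_ac)
        also have "k + (N - k) = N"
          using that by simp
        finally have "C * (norm (\<Lambda> (S ^ k)) * norm (\<Lambda> (S ^ (N - k) * R))) \<le>
            C * (norm (\<Lambda> 1) * L * \<rho> ^ N)"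
          using C(1) by (simp add: mult_left_mono)
        then show ?thesis
          using C(2)[OF SkM(1)[of k] SkM(2)[of "N - k"]] by (simp add: mult.assoc)
      qed
      then have "norm (\<Sum>k<Suc N. pairing T (S ^ k) (S ^ (N - k) * R)) \<le>
          real (card {..<Suc N}) * (C * norm (\<Lambda> 1) * L * \<rho> ^ N)"
        by (rule sum_norm_bound)
      then show ?thesis
        by (simp only: card_lessThan norm_mult) (rule mult_left_mono, simp_all)
    qed
    ultimately have "norm D \<le> norm \<xi> * (\<rho> ^ Suc N * L) + norm z * (C * (\<rho> ^ Suc N * L) * L) +
        norm z * (real (Suc N) * (C * norm (\<Lambda> 1) * L * \<rho> ^ N))"
      unfolding D by (meson add_mono norm_triangle_ineq4 order_trans)
    then show ?thesis
      by (simp add: A_def A'_def algebra_simps)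
  qed
  have "(\<lambda>N. \<rho> ^ Suc N) \<longlonglongrightarrow> 0"
    using \<rho> by (intro LIMSEQ_Suc LIMSEQ_power_zero) simp
  moreover have "(\<lambda>N. real N * \<rho> ^ N + \<rho> ^ N) \<longlonglongrightarrow> 0 + 0"
    using \<rho> by (intro tendsto_add powser_times_n_limit_0 LIMSEQ_power_zero) simp_all
  then have "(\<lambda>N. real (Suc N) * \<rho> ^ N) \<longlonglongrightarrow> 0"
    by (simp add: algebra_simps)
  ultimately have "(\<lambda>N. A * \<rho> ^ Suc N + A' * (real (Suc N) * \<rho> ^ N)) \<longlonglongrightarrow> A * 0 + A' * 0"
    by (intro tendsto_intros)
  then have "norm D \<le> A * 0 + A' * 0"
    by (rule LIMSEQ_le_const) (use bound in blast)
  then show ?thesis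
    by (simp add: D_def)
qed

text \<open>The resolvent identity \<open>\<partial> (P + i\<epsilon>)\<^sup>-\<^sup>1 = - (P + i\<epsilon>)\<^sup>-\<^sup>1 (\<partial>P) (P + i\<epsilon>)\<^sup>-\<^sup>1\<close>, seen through
  the conjugate vector and rescaled.  A geometric series in powers of \<open>P / \<epsilon>\<close> would diverge, as
  \<open>\<epsilon>\<close> may be much smaller than a bound \<open>K\<close> of \<open>P\<close>.  Instead \<open>P + i\<epsilon>\<close> is written as \<open>i L (1 - S)\<close>
  with \<open>L = (\<epsilon>\<^sup>2 + K\<^sup>2) / \<epsilon>\<close>: as \<open>P\<close> is self-adjoint, this makes \<open>S\<close> a strict contraction.\<close>

lemma conjugate_resolvent:
  assumes T: "T \<in> M" and P: "P \<in> M" "self_adjoint P" and \<epsilon>: "0 < \<epsilon>"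
    and mom: "\<And>z w N. cinner \<xi> (\<Lambda> ((z *\<^sub>C P + w *\<^sub>C 1) ^ N)) =
      z * (\<Sum>k<N. pairing T ((z *\<^sub>C P + w *\<^sub>C 1) ^ k) ((z *\<^sub>C P + w *\<^sub>C 1) ^ (N - 1 - k)))"
  shows "\<exists>g\<in>M. g * (P + (\<i> * of_real \<epsilon>) *\<^sub>C 1) = of_real \<epsilon> *\<^sub>C 1 \<and>
    (P + (\<i> * of_real \<epsilon>) *\<^sub>C 1) * g = of_real \<epsilon> *\<^sub>C 1 \<and>
    of_real \<epsilon> * cinner \<xi> (\<Lambda> g) = - pairing T g g"
proof -
  obtain K where K: "K > 0" "\<And>v. norm (app P v) \<le> K * norm v"
    using app_bound by blast
  define L where "L = (\<epsilon>\<^sup>2 + K\<^sup>2) / \<epsilon>"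
  define q where "q = \<epsilon> / L"
  define z where "z = \<i> / of_real L"
  define S where "S = z *\<^sub>C P + complex_of_real (1 - q) *\<^sub>C 1"
  have L: "L > 0" "\<epsilon> * L = \<epsilon>\<^sup>2 + K\<^sup>2"
    using \<epsilon> K(1) by (simp_all add: L_def add_pos_pos)
  have q: "0 < q" "q < 1"
    using \<epsilon> K(1) L by (simp_all add: q_def) (simp add: L_def field_simps power2_eq_square)
  have qK: "K\<^sup>2 / L\<^sup>2 = q * (1 - q)"
    using L by (simp add: q_def field_simps power2_eq_square)
  have SM: "S \<in> M"
    using P by (simp add: S_def M_closed)
  define \<rho> where "\<rho> = sqrt (1 - q)"
  have contr: "norm (app S v) \<le> \<rho> * norm v" for v
  proof -
    have S: "app S v = z *\<^sub>C app P v + (1 - q) *\<^sub>R v"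
      by (simp add: S_def app_simps scaleR_scaleC)
    \<comment> \<open>The cross term vanishes: \<open>z\<close> is imaginary and \<open>P\<close> is self-adjoint.\<close>
    have "Im (cinner v (app P v)) = 0"
      using cinner_adj_left[of P v v] cinner_commute[of v "app P v"] P(2)
      by (simp add: complex_eq_iff)
    then have cross: "inner v (z *\<^sub>C app P v) = 0"
      by (simp add: Re_cinner[symmetric] cinner_scaleC_right z_def)
    have "(norm (app S v))\<^sup>2 = (norm (z *\<^sub>C app P v))\<^sup>2 + (1 - q)\<^sup>2 * (norm v)\<^sup>2"
      unfolding S power2_norm_eq_inner
      using cross by (simp add: inner_simps inner_commute power2_eq_square)
    also have "norm (z *\<^sub>C app P v) = norm (app P v) / L"
      using L(1) by (simp add: norm_scaleC z_def norm_divide)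
    also have "(norm (app P v) / L)\<^sup>2 \<le> (K * norm v / L)\<^sup>2"
      using K L(1) by (intro power_mono divide_right_mono) auto
    also have "(K * norm v / L)\<^sup>2 = q * (1 - q) * (norm v)\<^sup>2"
      unfolding qK[symmetric] by (simp add: power_mult_distrib power_divide)
    finally have "(norm (app S v))\<^sup>2 \<le> (1 - q) * (norm v)\<^sup>2"
      by (simp add: algebra_simps power2_eq_square)
    also have "\<dots> = (\<rho> * norm v)\<^sup>2"
      using q by (simp add: \<rho>_def power_mult_distrib)
    finally show ?thesis
      by (rule power2_le_imp_le) (use q in \<open>simp add: \<rho>_def\<close>)
  qed
  have \<rho>: "0 \<le> \<rho>" "\<rho> < 1"
    using q by (simp_all add: \<rho>_def)
  obtain R where R: "R \<in> M" "R * (1 - S) = 1" "(1 - S) * R = 1"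
    using von_neumann_algebra_inverse[OF vN SM \<rho> contr] by blast
  have id: "cinner \<xi> (\<Lambda> R) = z * pairing T R R"
    by (rule conjugate_geometric_series[OF T SM \<rho> contr _ R(1,3)]) (unfold S_def, rule mom)
  define Z where "Z = P + (\<i> * of_real \<epsilon>) *\<^sub>C 1"
  have "z * (\<i> * of_real \<epsilon>) = - of_real q"
    by (simp add: z_def q_def)
  then have SZ: "1 - S = (- z) *\<^sub>C Z"
    by (simp add: S_def Z_def scaleC_add_right scaleC_scaleC scaleC_minus_left scaleC_diff_left)
  define g where "g = (- (of_real \<epsilon> * z)) *\<^sub>C R"
  have "g * Z = of_real \<epsilon> *\<^sub>C (R * (1 - S))" "Z * g = of_real \<epsilon> *\<^sub>C ((1 - S) * R)"
    by (simp_all add: g_def SZ scaleC_mult_left scaleC_mult_right scaleC_scaleC scaleC_minus_left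
        scaleC_minus_right)
  moreover have "of_real \<epsilon> * cinner \<xi> (\<Lambda> g) = - pairing T g g"
    using R(1) T
    by (simp add: g_def Lam_scaleC cinner_scaleC_right id pairing_scaleC M_closed)
  moreover have "g \<in> M"
    using R(1) by (simp add: g_def M_closed)
  ultimately show ?thesis
    using R(2,3) by (auto simp: Z_def)
qed


section \<open>Absence of a kernel\<close>

text \<open>Subtracting \<open>g\<^sup>* (P - i\<epsilon>) g = \<epsilon> g\<close> from \<open>g\<^sup>* (P + i\<epsilon>) g = \<epsilon> g\<^sup>*\<close> gives \<open>g\<^sup>* - g = 2 i y\<close>, so
  \<open>g + i y\<close> and \<open>- y\<close> are the real and imaginary parts of \<open>g\<close>; exchanging \<open>g\<close> and \<open>g\<^sup>*\<close> shows that
  \<open>g\<close> is normal.\<close>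

lemma resolvent_parts:
  fixes P g :: "'k::chilbert bop"
  assumes P: "self_adjoint P" and \<epsilon>: "0 < \<epsilon>"
    and left: "g * (P + (\<i> * of_real \<epsilon>) *\<^sub>C 1) = of_real \<epsilon> *\<^sub>C 1"
    and right: "(P + (\<i> * of_real \<epsilon>) *\<^sub>C 1) * g = of_real \<epsilon> *\<^sub>C 1"
  defines "y \<equiv> adj g * g" and "X \<equiv> g + \<i> *\<^sub>C (adj g * g)"
  shows "self_adjoint y" and "self_adjoint X" and "X * X = y - y * y"
    and "y * (P * P + of_real (\<epsilon>\<^sup>2) *\<^sub>C 1) = of_real (\<epsilon>\<^sup>2) *\<^sub>C 1"
    and "(P * P + of_real (\<epsilon>\<^sup>2) *\<^sub>C 1) * y = of_real (\<epsilon>\<^sup>2) *\<^sub>C 1"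
proof -
  define Z where "Z = P + (\<i> * of_real \<epsilon>) *\<^sub>C 1"
  have adjZ: "adj Z = P - (\<i> * of_real \<epsilon>) *\<^sub>C 1"
    using P by (simp add: Z_def adj_add adj_scaleC scaleC_minus_left)
  have gZ: "g * Z = of_real \<epsilon> *\<^sub>C 1" "Z * g = of_real \<epsilon> *\<^sub>C 1"
    using left right by (simp_all add: Z_def)
  have hZ: "adj Z * adj g = of_real \<epsilon> *\<^sub>C 1" "adj g * adj Z = of_real \<epsilon> *\<^sub>C 1"
    using arg_cong[OF gZ(1), of adj] arg_cong[OF gZ(2), of adj]
    by (simp_all add: adj_mult adj_scaleC)
  have ZZ: "Z - adj Z = (2 * (\<i> * of_real \<epsilon>)) *\<^sub>C 1"
    using scaleC_add_left[of "\<i> * of_real \<epsilon>" "\<i> * of_real \<epsilon>" "1 :: 'k bop"]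
    unfolding adjZ by (simp add: Z_def)
  have cancel: "a = b" if "of_real \<epsilon> *\<^sub>C a = of_real \<epsilon> *\<^sub>C b" for a b :: "'k bop"
    using arg_cong[OF that, of "\<lambda>t. of_real (1 / \<epsilon>) *\<^sub>C t"] \<epsilon> by (simp add: scaleC_scaleC)
  have y: "adj g - g = (2 * \<i>) *\<^sub>C y"
  proof (rule cancel)
    have "of_real \<epsilon> *\<^sub>C (adj g - g) = adj g * (Z * g) - (adj g * adj Z) * g"
      by (simp add: gZ hZ scaleC_mult_left scaleC_mult_right scaleC_diff_right)
    also have "\<dots> = adj g * (Z - adj Z) * g"
      by (simp add: algebra_simps)
    finally show "of_real \<epsilon> *\<^sub>C (adj g - g) = of_real \<epsilon> *\<^sub>C (2 * \<i>) *\<^sub>C y"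
      by (simp add: ZZ y_def scaleC_mult_left scaleC_mult_right scaleC_scaleC mult_ac)
  qed
  have y': "adj g - g = (2 * \<i>) *\<^sub>C (g * adj g)"
  proof (rule cancel)
    have "of_real \<epsilon> *\<^sub>C (adj g - g) = (g * Z) * adj g - g * (adj Z * adj g)"
      by (simp add: gZ hZ scaleC_mult_left scaleC_mult_right scaleC_diff_right)
    also have "\<dots> = g * (Z - adj Z) * adj g"
      by (simp add: algebra_simps)
    finally show "of_real \<epsilon> *\<^sub>C (adj g - g) = of_real \<epsilon> *\<^sub>C (2 * \<i>) *\<^sub>C (g * adj g)"
      by (simp add: ZZ scaleC_mult_left scaleC_mult_right scaleC_scaleC mult_ac)
  qed
  have "(1 / (2 * \<i>)) *\<^sub>C (adj g - g) = g * adj g"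
    unfolding y' by (simp add: scaleC_scaleC)
  moreover have "(1 / (2 * \<i>)) *\<^sub>C (adj g - g) = y"
    unfolding y by (simp add: scaleC_scaleC)
  ultimately have normal: "g * adj g = y"
    by simp
  show sy: "self_adjoint y"
    by (simp add: y_def adj_mult)
  have adjX: "adj X = adj g - \<i> *\<^sub>C y"
    using sy by (simp add: X_def adj_add adj_scaleC scaleC_minus_left flip: y_def)
  have "adj g = g + (2 * \<i>) *\<^sub>C y"
    using y by (simp add: algebra_simps)
  also have "(2 * \<i>) *\<^sub>C y = \<i> *\<^sub>C y + \<i> *\<^sub>C y"
    by (simp add: scaleC_add_left[symmetric])
  finally have adjg: "adj g = g + (\<i> *\<^sub>C y + \<i> *\<^sub>C y)" .
  show sX: "self_adjoint X"
    unfolding adjX adjg by (simp add: X_def y_def)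
  have comm: "y * g = g * y"
    unfolding y_def using normal by (simp add: y_def mult.assoc) (metis mult.assoc)
  have "X * X = adj X * X"
    by (simp add: sX)
  also have "\<dots> = (adj g - \<i> *\<^sub>C y) * (g + \<i> *\<^sub>C y)"
    unfolding adjX by (simp add: X_def y_def)
  also have "\<dots> = y + \<i> *\<^sub>C ((adj g - g) * y) + y * y"
    by (simp add: algebra_simps scaleC_mult_left scaleC_mult_right scaleC_scaleC scaleC_diff_right
        comm scaleC_minus_left flip: y_def)
  also have "\<i> *\<^sub>C ((adj g - g) * y) = - (y * y) - y * y"
  proof -
    have "\<i> * (2 * \<i>) = - 1 + - 1"
      by (simp add: complex_eq_iff)
    then have "\<i> *\<^sub>C ((adj g - g) * y) = (- 1 + - 1) *\<^sub>C (y * y)"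
      unfolding y by (simp only: scaleC_mult_left scaleC_scaleC)
    then show ?thesis
      by (simp only: scaleC_add_left scaleC_minus_left scaleC_one) simp
  qed
  finally show "X * X = y - y * y"
    by simp
  have H: "Z * adj Z = P * P + of_real (\<epsilon>\<^sup>2) *\<^sub>C 1" "adj Z * Z = P * P + of_real (\<epsilon>\<^sup>2) *\<^sub>C 1"
    unfolding adjZ unfolding Z_def
    by (simp_all add: algebra_simps scaleC_mult_left scaleC_mult_right scaleC_scaleC
        scaleC_minus_left scaleC_add_right scaleC_diff_right power2_eq_square)
  have "y * (Z * adj Z) = adj g * (g * Z) * adj Z"
    by (simp add: y_def mult.assoc)
  then show "y * (P * P + of_real (\<epsilon>\<^sup>2) *\<^sub>C 1) = of_real (\<epsilon>\<^sup>2) *\<^sub>C 1"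
    unfolding H by (simp add: gZ hZ scaleC_mult_left scaleC_mult_right scaleC_scaleC power2_eq_square)
  have "(adj Z * Z) * y = adj Z * (Z * g) * adj g"
    unfolding normal[symmetric] by (simp add: mult.assoc)
  then show "(P * P + of_real (\<epsilon>\<^sup>2) *\<^sub>C 1) * y = of_real (\<epsilon>\<^sup>2) *\<^sub>C 1"
    unfolding H by (simp add: gZ hZ scaleC_mult_left scaleC_mult_right scaleC_scaleC power2_eq_square)
qed

text \<open>Halving \<open>\<epsilon>\<close> turns \<open>y\<close> into a \<open>y'\<close> with \<open>4 y' = y + 3 y y'\<close>, so that
  \<open>4/3 (y - y') - (y - y\<^sup>2) = 3/4 y (1 - y') y \<ge> 0\<close>.  The trace of \<open>y - y\<^sup>2 = X\<^sup>2\<close> is thus controlled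
  by the decrease of the trace of \<open>y\<close> along a bounded sequence.\<close>

lemma resolvent_trace_decrease:
  assumes P: "P \<in> M" "self_adjoint P" and \<epsilon>: "0 < \<epsilon>"
    and g: "g \<in> M" "g * (P + (\<i> * of_real \<epsilon>) *\<^sub>C 1) = of_real \<epsilon> *\<^sub>C 1"
      "(P + (\<i> * of_real \<epsilon>) *\<^sub>C 1) * g = of_real \<epsilon> *\<^sub>C 1"
    and h: "h \<in> M" "h * (P + (\<i> * of_real (\<epsilon> / 2)) *\<^sub>C 1) = of_real (\<epsilon> / 2) *\<^sub>C 1"
      "(P + (\<i> * of_real (\<epsilon> / 2)) *\<^sub>C 1) * h = of_real (\<epsilon> / 2) *\<^sub>C 1"
  shows "(norm (\<Lambda> (g + \<i> *\<^sub>C (adj g * g))))\<^sup>2 \<le> 4/3 * (Re (\<tau> (adj g * g)) - Re (\<tau> (adj h * h)))"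
proof -
  define y X where "y = adj g * g" and "X = g + \<i> *\<^sub>C (adj g * g)"
  define y' X' where "y' = adj h * h" and "X' = h + \<i> *\<^sub>C (adj h * h)"
  note gp = resolvent_parts[OF P(2) \<epsilon> g(2,3), folded y_def X_def]
  have \<epsilon>2: "0 < \<epsilon> / 2"
    using \<epsilon> by simp
  note hp = resolvent_parts[OF P(2) \<epsilon>2 h(2,3), folded y'_def X'_def]
  have M: "y \<in> M" "X \<in> M" "y' \<in> M" "X' \<in> M"
    using g h by (simp_all add: y_def X_def y'_def X'_def M_closed)
  define e where "e = complex_of_real (\<epsilon>\<^sup>2)"
  define H' where "H' = P * P + (e / 4) *\<^sub>C 1"
  have e4: "complex_of_real ((\<epsilon> / 2)\<^sup>2) = e / 4"
    by (simp add: e_def power_divide)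
  have H: "P * P + e *\<^sub>C 1 = H' + (3 / 4 * e) *\<^sub>C 1"
    using scaleC_add_left[of "e / 4" "3 / 4 * e" "1 :: 'h bop"] by (simp add: H'_def algebra_simps)
  have yH: "y * (H' + (3 / 4 * e) *\<^sub>C 1) = e *\<^sub>C 1"
    using gp(4) by (simp only: e_def[symmetric] H)
  have Hy': "H' * y' = (e / 4) *\<^sub>C 1"
    using hp(5) by (simp only: e4 H'_def)
  have "e *\<^sub>C y' = y * (H' + (3 / 4 * e) *\<^sub>C 1) * y'"
    by (simp only: yH scaleC_mult_left mult_1_left)
  also have "\<dots> = y * (H' * y') + (3 / 4 * e) *\<^sub>C (y * y')"
    by (simp add: algebra_simps scaleC_mult_left scaleC_mult_right)
  also have "\<dots> = (e / 4) *\<^sub>C y + (3 / 4 * e) *\<^sub>C (y * y')"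
    by (simp add: Hy' scaleC_mult_right)
  finally have "(1 / e) *\<^sub>C (e *\<^sub>C y') = (1 / e) *\<^sub>C ((e / 4) *\<^sub>C y + (3 / 4 * e) *\<^sub>C (y * y'))"
    by simp
  then have rel: "y' = (1 / 4) *\<^sub>C y + (3 / 4) *\<^sub>C (y * y')"
    using \<epsilon> by (simp add: e_def scaleC_add_right scaleC_scaleC)
  have t1: "Re (\<tau> y') = Re (\<tau> y) / 4 + 3 / 4 * Re (\<tau> (y * y'))"
  proof -
    have "\<tau> y' = \<tau> ((1 / 4) *\<^sub>C y + (3 / 4) *\<^sub>C (y * y'))"
      using rel by simp
    also have "\<dots> = 1 / 4 * \<tau> y + 3 / 4 * \<tau> (y * y')"
      using M by (simp add: tau_add tau_scaleC M_closed)
    finally show ?thesis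
      by simp
  qed
  have t2: "Re (\<tau> (y * y')) = Re (\<tau> (y * y)) / 4 + 3 / 4 * Re (\<tau> (y * y' * y))"
  proof -
    have "y * y' = (1 / 4) *\<^sub>C (y * y) + (3 / 4) *\<^sub>C (y * (y * y'))"
      by (subst rel) (simp add: distrib_left scaleC_mult_right)
    then have "\<tau> (y * y') = \<tau> ((1 / 4) *\<^sub>C (y * y) + (3 / 4) *\<^sub>C (y * (y * y')))"
      by simp
    also have "\<dots> = 1 / 4 * \<tau> (y * y) + 3 / 4 * \<tau> (y * (y * y'))"
      using M by (simp add: tau_add tau_scaleC M_closed)
    also have "\<tau> (y * (y * y')) = \<tau> (y * y' * y)"
      using M tau_comm[of y "y * y'"] by (simp add: M_closed)
    finally show ?thesis
      by simp
  qed
  have "0 \<le> (norm (\<Lambda> ((1 - y') * y)))\<^sup>2 + (norm (\<Lambda> (X' * y)))\<^sup>2"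
    by simp
  also have "\<dots> = Re (\<tau> (adj ((1 - y') * y) * ((1 - y') * y) + adj (X' * y) * (X' * y)))"
    using M by (simp add: norm_Lam_sq M_closed tau_add)
  also have "adj ((1 - y') * y) * ((1 - y') * y) + adj (X' * y) * (X' * y) =
      y * ((1 - y') * (1 - y') + X' * X') * y"
    by (simp add: adj_mult adj_diff gp(1) hp(1,2) algebra_simps)
  also have "(1 - y') * (1 - y') + X' * X' = 1 - y'"
    by (simp add: hp(3) algebra_simps)
  also have "y * (1 - y') * y = y * y - y * y' * y"
    by (simp add: algebra_simps)
  also have "Re (\<tau> \<dots>) = Re (\<tau> (y * y)) - Re (\<tau> (y * y' * y))"
    using M by (simp add: tau_diff M_closed)
  finally have "Re (\<tau> (y * y' * y)) \<le> Re (\<tau> (y * y))"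
    by simp
  moreover have "(norm (\<Lambda> X))\<^sup>2 = Re (\<tau> y) - Re (\<tau> (y * y))"
    using M by (simp add: norm_Lam_sq gp(2,3) tau_diff M_closed)
  ultimately have "(norm (\<Lambda> X))\<^sup>2 \<le> 4/3 * (Re (\<tau> y) - Re (\<tau> y'))"
    using t1 t2 by simp
  then show ?thesis
    by (simp add: X_def y_def y'_def)
qed

text \<open>The main inequality at height \<open>\<epsilon>\<close>: the left hand side of the resolvent identity is at most
  \<open>\<epsilon> \<parallel>\<xi>\<parallel>\<close>, while up to the real part \<open>X\<close> of \<open>g\<close> its right hand side is the pairing of \<open>y\<close> with
  itself, which is at least \<open>c \<tau>(y)\<^sup>2\<close>; and \<open>y\<close> dominates the projection \<open>w\<close>.\<close>

lemma kernel_trace_estimate: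
  assumes T: "T \<in> M" "c *\<^sub>R 1 \<sqsubseteq> T" "0 \<le> c"
    and C: "0 \<le> C" "\<And>l r. l \<in> M \<Longrightarrow> r \<in> M \<Longrightarrow> norm (pairing T l r) \<le> C * norm (\<Lambda> l) * norm (\<Lambda> r)"
    and P: "P \<in> M" "self_adjoint P" and \<epsilon>: "0 < \<epsilon>"
    and g: "g \<in> M" "g * (P + (\<i> * of_real \<epsilon>) *\<^sub>C 1) = of_real \<epsilon> *\<^sub>C 1"
      "(P + (\<i> * of_real \<epsilon>) *\<^sub>C 1) * g = of_real \<epsilon> *\<^sub>C 1"
      "of_real \<epsilon> * cinner \<xi> (\<Lambda> g) = - pairing T g g"
    and w: "w \<in> M" "self_adjoint w" "w * w = w" "P * w = 0"
  shows "c * (Re (\<tau> w))\<^sup>2 \<le> \<epsilon> * norm \<xi> + 3 * C * norm (\<Lambda> (g + \<i> *\<^sub>C (adj g * g)))"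
proof -
  define y X where "y = adj g * g" and "X = g + \<i> *\<^sub>C (adj g * g)"
  note gp = resolvent_parts[OF P(2) \<epsilon> g(2,3), folded y_def X_def]
  have M: "y \<in> M" "X \<in> M"
    using g by (simp_all add: y_def X_def M_closed)
  have X2: "(norm (\<Lambda> X))\<^sup>2 = Re (\<tau> y) - (norm (\<Lambda> y))\<^sup>2"
    using M by (simp add: norm_Lam_sq gp(1-3) tau_diff M_closed)
  have g2: "(norm (\<Lambda> g))\<^sup>2 = Re (\<tau> y)"
    using g(1) by (simp add: norm_Lam_sq y_def)
  have y1: "Re (\<tau> y) \<le> 1"
  proof -
    have "0 \<le> (norm (\<Lambda> (1 - y)))\<^sup>2 + (norm (\<Lambda> X))\<^sup>2"
      by simp
    also have "\<dots> = Re (\<tau> ((1 - y) * (1 - y) + X * X))"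
      using M by (simp add: norm_Lam_sq M_closed tau_add adj_diff gp(1,2))
    also have "(1 - y) * (1 - y) + X * X = 1 - y"
      by (simp add: gp(3) algebra_simps)
    finally show ?thesis
      using M by (simp add: tau_diff M_closed tau_one)
  qed
  have le1: "norm (\<Lambda> g) \<le> 1" "norm (\<Lambda> X) \<le> 1"
  proof -
    have "(norm (\<Lambda> g))\<^sup>2 \<le> 1\<^sup>2" "(norm (\<Lambda> X))\<^sup>2 \<le> 1\<^sup>2"
      using g2 X2 y1 zero_le_power2[of "norm (\<Lambda> y)"] unfolding one_power2 by linarith+
    then show "norm (\<Lambda> g) \<le> 1" "norm (\<Lambda> X) \<le> 1"
      by (simp_all only: power2_le_imp_le zero_le_one)
  qed
  have w_le: "Re (\<tau> w) \<le> Re (\<tau> y)"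
  proof -
    have gw: "g * w = (- \<i>) *\<^sub>C w"
    proof -
      have "of_real \<epsilon> *\<^sub>C w = g * ((P + (\<i> * of_real \<epsilon>) *\<^sub>C 1) * w)"
        by (simp add: g(2) scaleC_mult_left flip: mult.assoc)
      also have "\<dots> = (\<i> * of_real \<epsilon>) *\<^sub>C (g * w)"
        by (simp add: distrib_right w(4) scaleC_mult_left scaleC_mult_right)
      finally have "(- \<i> / of_real \<epsilon>) *\<^sub>C (of_real \<epsilon> *\<^sub>C w) =
          (- \<i> / of_real \<epsilon>) *\<^sub>C ((\<i> * of_real \<epsilon>) *\<^sub>C (g * w))"
        by simp
      then show ?thesis
        using \<epsilon> by (simp add: scaleC_scaleC)
    qed
    have wg: "w * adj g = \<i> *\<^sub>C w"
      using arg_cong[OF gw, of adj] by (simp add: adj_mult adj_scaleC w(2))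
    have gs: "adj g * w = \<i> *\<^sub>C w"
    proof -
      have "adj g = g + (\<i> *\<^sub>C y + \<i> *\<^sub>C y)"
        using gp(2) arg_cong[OF X_def, of adj] gp(1)
        by (simp add: X_def adj_add adj_scaleC scaleC_minus_left algebra_simps flip: y_def)
      moreover have "y * w = w"
      proof -
        have "of_real (\<epsilon>\<^sup>2) *\<^sub>C w = y * ((P * P + of_real (\<epsilon>\<^sup>2) *\<^sub>C 1) * w)"
          by (simp only: mult.assoc[symmetric] gp(4) scaleC_mult_left mult_1_left)
        also have "\<dots> = of_real (\<epsilon>\<^sup>2) *\<^sub>C (y * w)"
          by (simp add: distrib_right w(4) mult.assoc scaleC_mult_left scaleC_mult_right)
        finally have "(1 / of_real (\<epsilon>\<^sup>2)) *\<^sub>C (of_real (\<epsilon>\<^sup>2) *\<^sub>C w) =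
            (1 / of_real (\<epsilon>\<^sup>2)) *\<^sub>C (of_real (\<epsilon>\<^sup>2) *\<^sub>C (y * w))"
          by simp
        then show ?thesis
          using \<epsilon> by (simp add: scaleC_scaleC)
      qed
      ultimately show ?thesis
        by (simp add: distrib_right gw scaleC_mult_left scaleC_minus_left)
    qed
    have wg': "w * g = (- \<i>) *\<^sub>C w"
      using arg_cong[OF gs, of adj] by (simp add: adj_mult adj_scaleC w(2))
    \<comment> \<open>The limit of \<open>g\<close> is \<open>- i w\<close>; its squared defect \<open>(g + i w)\<^sup>* (g + i w)\<close> shows \<open>y \<ge> w\<close>.\<close>
    have "adj (g + \<i> *\<^sub>C w) * (g + \<i> *\<^sub>C w) = y - w"
      by (simp add: adj_add adj_scaleC w algebra_simps scaleC_diff_right scaleC_mult_left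
          scaleC_mult_right gs wg' scaleC_scaleC scaleC_minus_left scaleC_minus_right y_def)
    then have "0 \<le> Re (\<tau> (y - w))"
      using norm_Lam_sq[of "g + \<i> *\<^sub>C w"] g(1) w(1) by (metis M_closed(3,6) zero_le_power2)
    then show ?thesis
      using M w(1) by (simp add: tau_diff)
  qed
  have w0: "0 \<le> Re (\<tau> w)"
    using norm_Lam_sq[of w] w by (metis zero_le_power2)
  have "c * (Re (\<tau> w))\<^sup>2 \<le> c * (Re (\<tau> y))\<^sup>2"
    using w0 w_le T(3) by (intro mult_left_mono power_mono) auto
  also have "\<dots> \<le> Re (pairing T y y)"
    using T M gp(1) by (intro pairing_self_adjoint_ge)
  also have "\<dots> \<le> norm (pairing T y y)"
    by (rule complex_Re_le_cmod)
  also have "pairing T y y = pairing T g X + pairing T X g - pairing T X X - pairing T g g"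
  proof -
    have yX: "y = \<i> *\<^sub>C (g - X)"
      by (simp add: X_def y_def scaleC_scaleC scaleC_minus_left scaleC_minus_right)
    have "pairing T y y = - pairing T (g - X) (g - X)"
      unfolding yX using T(1) M g(1) by (simp add: pairing_scaleC M_closed)
    also have "\<dots> = - (pairing T g g - pairing T X g - (pairing T g X - pairing T X X))"
      using T(1) M g(1) by (simp add: pairing_diff M_closed)
    finally show ?thesis
      by simp
  qed
  also have "norm \<dots> \<le> C * norm (\<Lambda> X) + C * norm (\<Lambda> X) + C * norm (\<Lambda> X) + \<epsilon> * norm \<xi>"
  proof -
    have shrink: "r \<le> C * norm (\<Lambda> X)" if "r \<le> C * s * t" "s * t \<le> norm (\<Lambda> X)" for r s t
      using that mult_left_mono[OF that(2) C(1)] by (simp add: mult.assoc)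
    have "norm (pairing T g X) \<le> C * norm (\<Lambda> X)"
      by (rule shrink[OF C(2)[OF g(1) M(2)]]) (simp add: le1 mult_left_le_one_le)
    moreover have "norm (pairing T X g) \<le> C * norm (\<Lambda> X)"
      by (rule shrink[OF C(2)[OF M(2) g(1)]]) (simp add: le1 mult_left_le)
    moreover have "norm (pairing T X X) \<le> C * norm (\<Lambda> X)"
      by (rule shrink[OF C(2)[OF M(2) M(2)]]) (simp add: le1 mult_left_le)
    moreover have "norm (pairing T g g) \<le> \<epsilon> * norm \<xi>"
    proof -
      have "norm (pairing T g g) = norm (of_real \<epsilon> * cinner \<xi> (\<Lambda> g))"
        by (simp add: g(4))
      also have "\<dots> = \<epsilon> * norm (cinner \<xi> (\<Lambda> g))"
        using \<epsilon> by (simp add: norm_mult)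
      also have "\<dots> \<le> \<epsilon> * (norm \<xi> * norm (\<Lambda> g))"
        using \<epsilon> by (intro mult_left_mono cinner_norm_bound) auto
      also have "\<dots> \<le> \<epsilon> * (norm \<xi> * 1)"
        using \<epsilon> le1(1) by (intro mult_left_mono) auto
      finally show ?thesis
        by simp
    qed
    moreover have "norm (u + v - s - t) \<le> norm u + norm v + norm s + norm t" for u v s t :: complex
      by (meson add_mono norm_triangle_ineq norm_triangle_ineq4 order_refl order_trans)
    ultimately show ?thesis
      by (meson add_mono order_trans)
  qed
  finally show ?thesis
    by (simp add: X_def)
qed

text \<open>Along \<open>\<epsilon> = 2\<^sup>-\<^sup>n\<close> the traces of \<open>y\<close> decrease and stay nonnegative, so their successive
  differences tend to zero; both error terms of the estimate then vanish in the limit, and the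
  trace does not see the projection onto the kernel.\<close>

lemma kernel_trivial:
  assumes T: "T \<in> M" "c *\<^sub>R 1 \<sqsubseteq> T" "0 < c"
    and P: "P \<in> M" "self_adjoint P"
    and mom: "\<And>z w N. cinner \<xi> (\<Lambda> ((z *\<^sub>C P + w *\<^sub>C 1) ^ N)) =
      z * (\<Sum>k<N. pairing T ((z *\<^sub>C P + w *\<^sub>C 1) ^ k) ((z *\<^sub>C P + w *\<^sub>C 1) ^ (N - 1 - k)))"
    and v: "app P v = 0"
  shows "v = 0"
proof -
  obtain C where C: "C > 0" "\<And>l r. l \<in> M \<Longrightarrow> r \<in> M \<Longrightarrow> norm (pairing T l r) \<le> C * norm (\<Lambda> l) * norm (\<Lambda> r)"
    using pairing_bounded[OF T(1)] by blast
  obtain w where w: "w \<in> M" "self_adjoint w" "w * w = w" "P * w = 0"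
    and ker: "\<And>v. app P v = 0 \<Longrightarrow> app w v = v"
    using kernel_projection[OF vN P(1)] by blast
  define e :: "nat \<Rightarrow> real" where "e n = (1 / 2) ^ n" for n
  have e: "0 < e n" "e (Suc n) = e n / 2" for n
    by (simp_all add: e_def)
  have "\<exists>g\<in>M. g * (P + (\<i> * of_real (e n)) *\<^sub>C 1) = of_real (e n) *\<^sub>C 1 \<and>
    (P + (\<i> * of_real (e n)) *\<^sub>C 1) * g = of_real (e n) *\<^sub>C 1 \<and>
    of_real (e n) * cinner \<xi> (\<Lambda> g) = - pairing T g g" for n
    by (rule conjugate_resolvent[OF T(1) P e(1) mom])
  then obtain g where g: "\<And>n. g n \<in> M"
    "\<And>n. g n * (P + (\<i> * of_real (e n)) *\<^sub>C 1) = of_real (e n) *\<^sub>C 1"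
    "\<And>n. (P + (\<i> * of_real (e n)) *\<^sub>C 1) * g n = of_real (e n) *\<^sub>C 1"
    "\<And>n. of_real (e n) * cinner \<xi> (\<Lambda> (g n)) = - pairing T (g n) (g n)"
    by metis
  define \<phi> where "\<phi> n = Re (\<tau> (adj (g n) * g n))" for n
  define X where "X n = g n + \<i> *\<^sub>C (adj (g n) * g n)" for n
  have dec: "(norm (\<Lambda> (X n)))\<^sup>2 \<le> 4/3 * (\<phi> n - \<phi> (Suc n))" for n
    unfolding X_def \<phi>_def
    by (rule resolvent_trace_decrease[OF P e(1)]) (use g[of n] g[of "Suc n"] in \<open>simp_all only: e(2)\<close>)
  have "\<phi> (Suc n) \<le> \<phi> n" for n
    using order_trans[OF zero_le_power2 dec, of n] by simp
  then have "decseq \<phi>"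
    by (rule decseq_SucI)
  moreover have "0 \<le> \<phi> n" for n
    using norm_Lam_sq[OF g(1), of n] by (metis \<phi>_def zero_le_power2)
  ultimately obtain l where l: "\<phi> \<longlonglongrightarrow> l"
    using decseq_convergent[of \<phi> 0] by blast
  have "(\<lambda>n. 4/3 * (\<phi> n - \<phi> (Suc n))) \<longlonglongrightarrow> 4/3 * (l - l)"
    by (intro tendsto_intros l LIMSEQ_Suc)
  then have "(\<lambda>n. 4/3 * (\<phi> n - \<phi> (Suc n))) \<longlonglongrightarrow> 0"
    by simp
  then have "(\<lambda>n. (norm (\<Lambda> (X n)))\<^sup>2) \<longlonglongrightarrow> 0"
    by (rule Lim_null_comparison[rotated]) (use dec in simp)
  then have "(\<lambda>n. sqrt ((norm (\<Lambda> (X n)))\<^sup>2)) \<longlonglongrightarrow> sqrt 0"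
    by (rule tendsto_real_sqrt)
  then have X0: "(\<lambda>n. norm (\<Lambda> (X n))) \<longlonglongrightarrow> 0"
    by simp
  have "e \<longlonglongrightarrow> 0"
    unfolding e_def by (rule LIMSEQ_power_zero) simp
  then have "(\<lambda>n. e n * norm \<xi> + 3 * C * norm (\<Lambda> (X n))) \<longlonglongrightarrow> 0 * norm \<xi> + 3 * C * 0"
    by (intro tendsto_intros X0)
  moreover have "c * (Re (\<tau> w))\<^sup>2 \<le> e n * norm \<xi> + 3 * C * norm (\<Lambda> (X n))" for n
    unfolding X_def using T C P e(1) g w by (intro kernel_trace_estimate) (auto intro: less_imp_le)
  ultimately have "c * (Re (\<tau> w))\<^sup>2 \<le> 0 * norm \<xi> + 3 * C * 0"
    by (intro LIMSEQ_le_const) blast+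
  then have "Re (\<tau> w) = 0"
    using T(3) by (simp add: mult_le_0_iff)
  then have "(norm (\<Lambda> w))\<^sup>2 = 0"
    using norm_Lam_sq[OF w(1)] w by simp
  then have "\<tau> (adj w * w) = 0"
    using cinner_Lam[OF w(1) w(1)] by simp
  then have "w = 0"
    using tau_faithful w(1) by blast
  then show "v = 0"
    using ker[OF v] by (simp add: app_simps)
qed

text \<open>Subtracting an element of \<open>B\<close> from \<open>P\<close> only changes \<open>b\<^sub>0\<close>, so atoms in \<open>B\<close> are kernels of
  elements of the same form.  An affine function \<open>z (P - s) + u\<close> has this form too, with \<open>T\<close>
  replaced by \<open>z T\<close>; this is how the resolvent of \<open>P - s\<close> comes within reach of the Leibniz rule.\<close>

lemma no_atoms_in_linear:
  assumes conj: "conjugate_variable B \<tau> E \<Lambda> \<eta> x i \<xi>"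
    and \<eta>: "\<And>j. linear_on B (\<eta> i j)" "\<And>j. \<forall>q\<in>B. \<eta> i j q \<in> B"
    and x: "\<And>i. x i \<in> M"
    and J: "finite J"
    and ab: "\<And>t. t \<in> J \<Longrightarrow> a t \<in> B" "\<And>t. t \<in> J \<Longrightarrow> b t \<in> B" "b0 \<in> B"
    and diag: "\<And>t q. t \<in> J \<Longrightarrow> q \<in> M \<Longrightarrow>
      extend_cov E \<eta> i (\<iota> t) q = (if \<iota> t = i then E q else 0)"
    and P: "P = (\<Sum>t\<in>J. a t * x (\<iota> t) * b t) + b0" "self_adjoint P"
    and c: "0 < c" "c *\<^sub>R 1 \<sqsubseteq> (\<Sum>t\<in>{t\<in>J. \<iota> t = i}. a t * b t)"
  shows "no_atoms_in B P"
  unfolding no_atoms_in_def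
proof (intro ballI impI)
  fix s assume s: "s \<in> B" "self_adjoint s"
  define T where "T = (\<Sum>t\<in>{t\<in>J. \<iota> t = i}. a t * b t)"
  have T: "T \<in> M"
    unfolding T_def using ab
    by (intro von_neumann_algebra_sum_closed[OF vN]) (auto simp: M_closed B_in_M)
  have PM: "P \<in> M"
    unfolding P(1) using ab x
    by (intro M_closed von_neumann_algebra_sum_closed[OF vN]) (auto simp: B_in_M)
  have "v = 0" if "app (P - s) v = 0" for v
  proof (rule kernel_trivial[OF T _ c(1) _ _ _ that])
    show "c *\<^sub>R 1 \<sqsubseteq> T"
      using c(2) by (simp add: T_def)
    show "P - s \<in> M" "self_adjoint (P - s)"
      using PM s P(2) by (simp_all add: M_closed B_in_M adj_diff)
    fix z u N
    have S: "z *\<^sub>C (P - s) + u *\<^sub>C 1 =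
        (\<Sum>t\<in>J. (z *\<^sub>C a t) * x (\<iota> t) * b t) + (z *\<^sub>C (b0 - s) + u *\<^sub>C 1)"
      by (simp add: P(1) scaleC_add_right scaleC_diff_right scaleC_sum_right scaleC_mult_left)
    have zT: "(\<Sum>t\<in>{t\<in>J. \<iota> t = i}. (z *\<^sub>C a t) * b t) = z *\<^sub>C T"
      by (simp add: T_def scaleC_sum_right scaleC_mult_left)
    have Sk: "(z *\<^sub>C (P - s) + u *\<^sub>C 1) ^ k \<in> M" for k
      using PM s by (simp add: M_closed B_in_M)
    have "cinner \<xi> (\<Lambda> ((z *\<^sub>C (P - s) + u *\<^sub>C 1) ^ N)) =
        (\<Sum>k<N. pairing (z *\<^sub>C T) ((z *\<^sub>C (P - s) + u *\<^sub>C 1) ^ k)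
          ((z *\<^sub>C (P - s) + u *\<^sub>C 1) ^ (N - 1 - k)))"
      unfolding zT[symmetric]
      by (rule conjugate_variable_power[OF conj \<eta> x J _ _ _ _ S])
        (use diag ab s in \<open>simp_all add: B_closed\<close>)
    also have "\<dots> = z * (\<Sum>k<N. pairing T ((z *\<^sub>C (P - s) + u *\<^sub>C 1) ^ k)
          ((z *\<^sub>C (P - s) + u *\<^sub>C 1) ^ (N - 1 - k)))"
      unfolding sum_distrib_left using T Sk by (intro sum.cong refl pairing_scaleC(3))
    finally show "cinner \<xi> (\<Lambda> ((z *\<^sub>C (P - s) + u *\<^sub>C 1) ^ N)) =
        z * (\<Sum>k<N. pairing T ((z *\<^sub>C (P - s) + u *\<^sub>C 1) ^ k)
          ((z *\<^sub>C (P - s) + u *\<^sub>C 1) ^ (N - 1 - k)))" .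
  qed
  then show "{v. app (P - s) v = 0} = {0}"
    by (auto simp: app_zero)
qed

end

theorem theoremB:
  fixes M B :: "'h::chilbert bop set"
    and \<tau> :: "'h bop \<Rightarrow> complex"
    and E :: "'h bop \<Rightarrow> 'h bop"
    and \<Lambda> :: "'h bop \<Rightarrow> 'l::chilbert"
    and x :: "'i::countable \<Rightarrow> 'h bop"
    and \<eta> :: "'i \<Rightarrow> 'i \<Rightarrow> 'h bop \<Rightarrow> 'h bop"
  assumes "tracial_von_neumann_algebra M \<tau>"
    and "von_neumann_algebra B" and "B \<subseteq> M"
    and "\<And>i. x i \<in> M" and "\<And>i. self_adjoint (x i)"
    and "M = commutant (commutant (star_alg (B \<union> range x)))"
    and "gns_space M \<tau> \<Lambda>"
    and "trace_preserving_expectation M B \<tau> E"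
    and "covariance_matrix B \<eta>"
    and "trace_symmetric B \<tau> \<eta>"
    and "\<And>i a. a \<in> M \<Longrightarrow> extend_cov E \<eta> i i a = E a"
    and "\<exists>\<xi>. conjugate_system B \<tau> E \<Lambda> \<eta> x \<xi>"
  shows "(\<forall>i (n::nat) a b b0 P (c::real).
            (\<forall>j<n. a j \<in> B \<and> b j \<in> B) \<and> b0 \<in> B \<and>
            P = (\<Sum>j<n. a j * x i * b j) + b0 \<and> self_adjoint P \<and>
            0 < c \<and> c *\<^sub>R 1 \<sqsubseteq> (\<Sum>j<n. a j * b j)
            \<longrightarrow> no_atoms_in B P) \<and>
         ((\<forall>i j. \<forall>a\<in>M. extend_cov E \<eta> i j a = (if i = j then E a else 0)) \<longrightarrow>
          (\<forall>F (n::'i \<Rightarrow> nat) a b b0 P i (c::real).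
            finite F \<and> (\<forall>k\<in>F. \<forall>j<n k. a k j \<in> B \<and> b k j \<in> B) \<and> b0 \<in> B \<and>
            P = (\<Sum>k\<in>F. \<Sum>j<n k. a k j * x k * b k j) + b0 \<and> self_adjoint P \<and>
            i \<in> F \<and> 0 < c \<and> c *\<^sub>R 1 \<sqsubseteq> (\<Sum>j<n i. a i j * b i j)
            \<longrightarrow> no_atoms_in B P))"
proof -
  interpret tracial_inclusion M \<tau> \<Lambda> B E
    using assms(1-3,7,8) by unfold_locales
  obtain \<xi> where \<xi>: "\<And>i. conjugate_variable B \<tau> E \<Lambda> \<eta> x i (\<xi> i)"
    using assms(12) by (auto simp: conjugate_system_def)
  have \<eta>: "\<And>i j. linear_on B (\<eta> i j)" "\<And>i j. \<forall>q\<in>B. \<eta> i j q \<in> B"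
    using assms(9) by (auto simp: covariance_matrix_def)
  note linear = no_atoms_in_linear[OF \<xi> \<eta> assms(4)]
  show ?thesis
  proof (intro conjI allI impI; elim conjE)
    fix i :: 'i and n :: nat and a b b0 P and c :: real
    assume ab: "\<forall>j<n. a j \<in> B \<and> b j \<in> B" "b0 \<in> B"
      and P: "P = (\<Sum>j<n. a j * x i * b j) + b0" "self_adjoint P"
      and c: "0 < c" "c *\<^sub>R 1 \<sqsubseteq> (\<Sum>j<n. a j * b j)"
    show "no_atoms_in B P"
    proof (rule linear[where J = "{..<n}" and \<iota> = "\<lambda>_. i" and a = a and b = b])
      show "P = (\<Sum>j\<in>{..<n}. a j * x i * b j) + b0"
        by (rule P(1))
      show "c *\<^sub>R 1 \<sqsubseteq> (\<Sum>j\<in>{j \<in> {..<n}. i = i}. a j * b j)"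
        using c(2) by (simp add: lessThan_def)
    qed (use ab P(2) c(1) assms(11) in auto)
  next
    fix F :: "'i set" and n :: "'i \<Rightarrow> nat" and a b b0 P i and c :: real
    assume diag: "\<forall>i j. \<forall>a\<in>M. extend_cov E \<eta> i j a = (if i = j then E a else 0)"
      and F: "finite F" "i \<in> F"
      and ab: "\<forall>k\<in>F. \<forall>j<n k. a k j \<in> B \<and> b k j \<in> B" "b0 \<in> B"
      and P: "P = (\<Sum>k\<in>F. \<Sum>j<n k. a k j * x k * b k j) + b0" "self_adjoint P"
      and c: "0 < c" "c *\<^sub>R 1 \<sqsubseteq> (\<Sum>j<n i. a i j * b i j)"
    define J where "J = Sigma F (\<lambda>k. {..<n k})"
    have "{t \<in> J. fst t = i} = Pair i ` {..<n i}"
      using F by (auto simp: J_def)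
    then have T: "(\<Sum>t\<in>{t\<in>J. fst t = i}. a (fst t) (snd t) * b (fst t) (snd t)) =
        (\<Sum>j<n i. a i j * b i j)"
      by (simp add: sum.reindex inj_on_def)
    have PJ: "P = (\<Sum>t\<in>J. a (fst t) (snd t) * x (fst t) * b (fst t) (snd t)) + b0"
      unfolding P(1) J_def using F by (simp add: sum.Sigma case_prod_unfold)
    show "no_atoms_in B P"
    proof (rule linear[OF _ _ _ _ _ PJ P(2) c(1)])
      show "c *\<^sub>R 1 \<sqsubseteq> (\<Sum>t\<in>{t\<in>J. fst t = i}. a (fst t) (snd t) * b (fst t) (snd t))"
        using c(2) by (simp only: T)
    qed (use F ab diag in \<open>auto simp: J_def\<close>)
  qed
qed

end
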